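(* Let $MPR$ and $dWHA$ be the connected graded Hopf algebras described in the context. The $\mathbf{Z}$-linear map $\varphi: MPR\to dWHA$ defined on permutation words by $\varphi([t_1,\dots,t_n])=\binom{[x_1,x_2,\dots,x_n]}{[x_{t_1},x_{t_2},\dots,x_{t_n}]}$ (and sending the empty permutation to the empty substitution) is a monomorphism of connected graded Hopf algebras.
   Context: $MPR$: the free Abelian group $\mathbf{Z}\oplus\bigoplus_{n\ge1}\mathbf{Z}S_n$ with basis the empty word $[\,]$ and all permutation words $[s_1,\dots,s_m]$ (words over $\{1,\dots,m\}$ without repeats, representing $i\mapsto s_i$), graded by length. The shuffle product $\times_{sh}$ of words $[a_1,\dots,a_m]$, $[b_1,\dots,b_n]$ is the sum with multiplicities of all interleavings preserving the relative order of the $a$'s and of the $b$'s. Multiplication on $MPR$: $[a_1,\dots,a_m]\cdot[b_1,\dots,b_n]=[a_1,\dots,a_m]\times_{sh}[m+b_1,\dots,m+b_n]$, unit $[\,]$. For a word $\alpha=[a_1,\dots,a_m]$ over positive integers without repeats, $st(\alpha)=[\psi(a_1),\dots,\psi(a_m)]$ with $\psi:\{a_1,\dots,a_m\}\to\{1,\dots,m\}$ the unique strictly increasing bijection. Comultiplication on $MPR$: $\mu(\alpha)=\sum_{\alpha=\alpha_1\alpha_2}st(\alpha_1)\otimes st(\alpha_2)$ over all cuts (concatenation decompositions, trivial ones included); counit is $1$ on $[\,]$ and $0$ on $S_n$, $n\ge1$. $dWHA$: fix an alphabet $\mathcal{X}=\{x_1,x_2,\dots\}$; a substitution is a pair of words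 $\binom{\rho}{\sigma}$ over $\mathcal{X}$ with equal supports (support = set of distinct letters), up to simultaneous renaming of letters by a bijection; $dWHA$ is free Abelian on substitutions (including the empty one), graded by $\deg\binom{\rho}{\sigma}=\#\mathrm{supp}(\rho)$. Product: writing two substitutions with disjoint supports, $\binom{\rho}{\sigma}\cdot\binom{\rho'}{\sigma'}=\sum_\gamma\binom{\rho\rho'}{\gamma}$ over terms $\gamma$ of $\sigma\times_{sh}\sigma'$. A cut $\sigma=\sigma_1\sigma_2$ is good if $\mathrm{supp}(\sigma_1)\cap\mathrm{supp}(\sigma_2)=\emptyset$; for $p=\binom{\rho}{\sigma}$, $p^{-1}(\sigma_1)$ is the subword of $\rho$ of all letters in $\mathrm{supp}(\sigma_1)$. Coproduct: $\mu\binom{\rho}{\sigma}=\sum\binom{p^{-1}(\sigma_1)}{\sigma_1}\otimes\binom{p^{-1}(\sigma_2)}{\sigma_2}$ over good cuts. Unit is the empty substitution, counit is $1$ on it and $0$ on others; the antipodes are the unique ones of these connected graded bialgebras. *)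

theory Defs
  imports Complex_Main "HOL-Library.Poly_Mapping"
begin

section \<open>Graded Hopf algebras with a homogeneous basis\<close>

text \<open>
  The free Abelian group with basis \<^typ>\<open>'b\<close> is the type \<^typ>\<open>'b \<Rightarrow>\<^sub>0 int\<close>, so the tensor
  product of the free Abelian groups on \<^typ>\<open>'a\<close> and \<^typ>\<open>'b\<close> is \<^typ>\<open>'a \<times> 'b \<Rightarrow>\<^sub>0 int\<close>,
  with \<open>a \<otimes> b\<close> being the basis element \<^term>\<open>(a, b)\<close>.
\<close>

definition tens :: "('a \<Rightarrow>\<^sub>0 int) \<Rightarrow> ('b \<Rightarrow>\<^sub>0 int) \<Rightarrow> ('a \<times> 'b \<Rightarrow>\<^sub>0 int)" where
  "tens x y = frag_extend (\<lambda>a. frag_extend (\<lambda>b. frag_of (a, b)) y) x"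

definition tens_map :: "(('a \<Rightarrow>\<^sub>0 int) \<Rightarrow> ('c \<Rightarrow>\<^sub>0 int)) \<Rightarrow> (('b \<Rightarrow>\<^sub>0 int) \<Rightarrow> ('d \<Rightarrow>\<^sub>0 int)) \<Rightarrow>
    ('a \<times> 'b \<Rightarrow>\<^sub>0 int) \<Rightarrow> ('c \<times> 'd \<Rightarrow>\<^sub>0 int)" where
  "tens_map f g = frag_extend (\<lambda>(a, b). tens (f (frag_of a)) (g (frag_of b)))"

definition tens_assoc :: "(('a \<times> 'b) \<times> 'c \<Rightarrow>\<^sub>0 int) \<Rightarrow> ('a \<times> 'b \<times> 'c \<Rightarrow>\<^sub>0 int)" where
  "tens_assoc = frag_extend (\<lambda>((a, b), c). frag_of (a, b, c))"

text \<open>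
  The data of a graded bialgebra \<open>H\<close> over the integers whose underlying group is free with a
  basis of homogeneous elements: \<open>mul : H \<otimes> H \<rightarrow> H\<close>, the unit element, \<open>comul : H \<rightarrow> H \<otimes> H\<close>,
  \<open>counit : H \<rightarrow> \<int>\<close>, and the degrees of the basis elements.
\<close>

record 'b bialg =
  mul :: "('b \<times> 'b \<Rightarrow>\<^sub>0 int) \<Rightarrow> ('b \<Rightarrow>\<^sub>0 int)"
  unit :: "'b \<Rightarrow>\<^sub>0 int"
  comul :: "('b \<Rightarrow>\<^sub>0 int) \<Rightarrow> ('b \<times> 'b \<Rightarrow>\<^sub>0 int)"
  counit :: "('b \<Rightarrow>\<^sub>0 int) \<Rightarrow> int"
  deg :: "'b \<Rightarrow> nat"

definition hcomp :: "'b bialg \<Rightarrow> nat \<Rightarrow> ('b \<Rightarrow>\<^sub>0 int) set" where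
  "hcomp H n = {x. \<forall>b \<in> Poly_Mapping.keys x. deg H b = n}"

text \<open>The degree \<open>n\<close> part \<open>\<Oplus>\<^bsub>i+j=n\<^esub> H\<^sub>i \<otimes> H\<^sub>j\<close> of \<open>H \<otimes> H\<close>.\<close>

definition hcomp2 :: "'b bialg \<Rightarrow> nat \<Rightarrow> ('b \<times> 'b \<Rightarrow>\<^sub>0 int) set" where
  "hcomp2 H n = {u. \<forall>(a, b) \<in> Poly_Mapping.keys u. deg H a + deg H b = n}"

text \<open>\<open>(a \<otimes> b)(c \<otimes> d) = ac \<otimes> bd\<close>.\<close>

definition mul2 :: "'b bialg \<Rightarrow> ('b \<times> 'b \<Rightarrow>\<^sub>0 int) \<Rightarrow> ('b \<times> 'b \<Rightarrow>\<^sub>0 int) \<Rightarrow> ('b \<times> 'b \<Rightarrow>\<^sub>0 int)" where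
  "mul2 H u v = frag_extend
     (\<lambda>((a, b), (c, d)). tens (mul H (frag_of (a, c))) (mul H (frag_of (b, d)))) (tens u v)"

definition is_algebra :: "'b bialg \<Rightarrow> bool" where
  "is_algebra H \<longleftrightarrow>
     additive (mul H) \<and>
     (\<forall>x y z. mul H (tens (mul H (tens x y)) z) = mul H (tens x (mul H (tens y z)))) \<and>
     (\<forall>x. mul H (tens (unit H) x) = x \<and> mul H (tens x (unit H)) = x)"

definition is_coalgebra :: "'b bialg \<Rightarrow> bool" where
  "is_coalgebra H \<longleftrightarrow>
     additive (comul H) \<and> additive (counit H) \<and>
     (\<forall>x. tens_assoc (tens_map (comul H) id (comul H x)) = tens_map id (comul H) (comul H x)) \<and>
     (\<forall>x. frag_extend (\<lambda>(a, b). frag_cmul (counit H (frag_of a)) (frag_of b)) (comul H x) = x \<and>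
          frag_extend (\<lambda>(a, b). frag_cmul (counit H (frag_of b)) (frag_of a)) (comul H x) = x)"

definition is_bialgebra :: "'b bialg \<Rightarrow> bool" where
  "is_bialgebra H \<longleftrightarrow>
     is_algebra H \<and> is_coalgebra H \<and>
     (\<forall>x y. comul H (mul H (tens x y)) = mul2 H (comul H x) (comul H y)) \<and>
     comul H (unit H) = tens (unit H) (unit H) \<and>
     (\<forall>x y. counit H (mul H (tens x y)) = counit H x * counit H y) \<and>
     counit H (unit H) = 1"

definition is_antipode :: "'b bialg \<Rightarrow> (('b \<Rightarrow>\<^sub>0 int) \<Rightarrow> ('b \<Rightarrow>\<^sub>0 int)) \<Rightarrow> bool" where
  "is_antipode H S \<longleftrightarrow>
     additive S \<and>
     (\<forall>x. mul H (tens_map S id (comul H x)) = frag_cmul (counit H x) (unit H) \<and>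
          mul H (tens_map id S (comul H x)) = frag_cmul (counit H x) (unit H))"

definition antipode :: "'b bialg \<Rightarrow> ('b \<Rightarrow>\<^sub>0 int) \<Rightarrow> ('b \<Rightarrow>\<^sub>0 int)" where
  "antipode H = (THE S. is_antipode H S)"

definition is_hopf_algebra :: "'b bialg \<Rightarrow> bool" where
  "is_hopf_algebra H \<longleftrightarrow> is_bialgebra H \<and> (\<exists>!S. is_antipode H S)"

definition is_graded_hopf_algebra :: "'b bialg \<Rightarrow> bool" where
  "is_graded_hopf_algebra H \<longleftrightarrow>
     is_hopf_algebra H \<and>
     (\<forall>n. mul H ` hcomp2 H n \<subseteq> hcomp H n) \<and>
     unit H \<in> hcomp H 0 \<and>
     (\<forall>n. comul H ` hcomp H n \<subseteq> hcomp2 H n) \<and>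
     (\<forall>n>0. \<forall>x \<in> hcomp H n. counit H x = 0) \<and>
     (\<forall>n. antipode H ` hcomp H n \<subseteq> hcomp H n)"

text \<open>Connectedness: the unit map identifies the integers with the degree \<open>0\<close> component.\<close>

definition is_connected_graded_hopf_algebra :: "'b bialg \<Rightarrow> bool" where
  "is_connected_graded_hopf_algebra H \<longleftrightarrow>
     is_graded_hopf_algebra H \<and> bij_betw (\<lambda>k. frag_cmul k (unit H)) UNIV (hcomp H 0)"

definition is_graded_hopf_hom ::
    "'a bialg \<Rightarrow> 'b bialg \<Rightarrow> (('a \<Rightarrow>\<^sub>0 int) \<Rightarrow> ('b \<Rightarrow>\<^sub>0 int)) \<Rightarrow> bool" where
  "is_graded_hopf_hom H K f \<longleftrightarrow>
     additive f \<and>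
     (\<forall>x y. f (mul H (tens x y)) = mul K (tens (f x) (f y))) \<and>
     f (unit H) = unit K \<and>
     (\<forall>x. comul K (f x) = tens_map f f (comul H x)) \<and>
     (\<forall>x. counit K (f x) = counit H x) \<and>
     (\<forall>x. f (antipode H x) = antipode K (f x)) \<and>
     (\<forall>n. f ` hcomp H n \<subseteq> hcomp K n)"

definition connected_graded_hopf_mono ::
    "'a bialg \<Rightarrow> 'b bialg \<Rightarrow> (('a \<Rightarrow>\<^sub>0 int) \<Rightarrow> ('b \<Rightarrow>\<^sub>0 int)) \<Rightarrow> bool" where
  "connected_graded_hopf_mono H K f \<longleftrightarrow>
     is_connected_graded_hopf_algebra H \<and> is_connected_graded_hopf_algebra K \<and>
     is_graded_hopf_hom H K f \<and> inj f"


section \<open>Words\<close>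

text \<open>The list of all interleavings, an interleaving occurring as often as it arises. (The
  library's \<^const>\<open>shuffles\<close> is a set and forgets the multiplicities.)\<close>

fun shuffle :: "'a list \<Rightarrow> 'a list \<Rightarrow> 'a list list" where
  "shuffle [] bs = [bs]"
| "shuffle as [] = [as]"
| "shuffle (a # as) (b # bs) =
     map ((#) a) (shuffle as (b # bs)) @ map ((#) b) (shuffle (a # as) bs)"

lemma set_shuffle: "set (shuffle as bs) = shuffles as bs"
  by (induction as bs rule: shuffle.induct) auto

lemma length_shuffle: "length (shuffle as bs) = (length as + length bs) choose length as"
  by (induction as bs rule: shuffle.induct) (auto simp: add.commute)

lemma shuffle_map: "shuffle (map f as) (map f bs) = map (map f) (shuffle as bs)"
  by (induction as bs rule: shuffle.induct) auto

definition cuts :: "'a list \<Rightarrow> ('a list \<times> 'a list) set" where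
  "cuts w = {(u, v). u @ v = w}"

lemma cuts_eq: "cuts w = (\<lambda>k. (take k w, drop k w)) ` {..length w}"
proof -
  have "(u, v) \<in> (\<lambda>k. (take k w, drop k w)) ` {..length w}" if "u @ v = w" for u v
    using that by (intro image_eqI[of _ _ "length u"]) auto
  then show ?thesis
    unfolding cuts_def by auto
qed

lemma finite_cuts: "finite (cuts w)"
  by (simp add: cuts_eq)


section \<open>The Hopf algebra of permutations\<close>

typedef perm_word = "{w :: nat list. distinct w \<and> set w = {1..length w}}"
  by (rule exI[of _ "[]"]) simp

definition st_map :: "nat list \<Rightarrow> nat \<Rightarrow> nat" where
  "st_map w a = card {b \<in> set w. b \<le> a}"

definition st :: "nat list \<Rightarrow> nat list" where
  "st w = map (st_map w) w"

text \<open>\<^const>\<open>st_map\<close> is the unique increasing bijection used for standardization.\<close>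

lemma st_map_unique:
  assumes "distinct w" "strict_mono_on (set w) f" "bij_betw f (set w) {1..length w}" "a \<in> set w"
  shows "f a = st_map w a"
proof -
  have im: "f ` set w = {1..length w}" and inj: "inj_on f (set w)"
    using assms(3) by (auto simp: bij_betw_def)
  have le_iff: "f b \<le> f c \<longleftrightarrow> b \<le> c" if "b \<in> set w" "c \<in> set w" for b c
    using strict_mono_onD[OF assms(2) that] strict_mono_onD[OF assms(2) that(2,1)]
    by (metis le_less_linear less_le_not_le order.order_iff_strict)
  have "f ` {b \<in> set w. b \<le> a} = {1..f a}"
  proof (intro equalityI subsetI)
    fix y assume "y \<in> f ` {b \<in> set w. b \<le> a}"
    then show "y \<in> {1..f a}"
      using im le_iff assms(4) by (metis (no_types, lifting) atLeastAtMost_iff image_iff mem_Collect_eq)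
  next
    fix y assume y: "y \<in> {1..f a}"
    have "f a \<in> {1..length w}"
      using im assms(4) by blast
    then have "y \<in> f ` set w"
      using y im by simp
    then show "y \<in> f ` {b \<in> set w. b \<le> a}"
      using y le_iff assms(4) by auto
  qed
  moreover have "inj_on f {b \<in> set w. b \<le> a}"
    using inj by (rule inj_on_subset) auto
  ultimately show ?thesis
    unfolding st_map_def by (metis card_image card_atLeastAtMost diff_Suc_1)
qed

lemma st_map_strict_mono: "strict_mono_on (set w) (st_map w)"
proof (rule strict_mono_onI)
  fix a b assume "a \<in> set w" "b \<in> set w" "a < b"
  then have "{c \<in> set w. c \<le> a} \<subset> {c \<in> set w. c \<le> b}"
    by force
  then show "st_map w a < st_map w b"
    unfolding st_map_def by (intro psubset_card_mono) auto
qed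

lemma st_map_bij:
  assumes "distinct w"
  shows "bij_betw (st_map w) (set w) {1..length w}"
proof -
  have inj: "inj_on (st_map w) (set w)"
    by (rule strict_mono_on_imp_inj_on[OF st_map_strict_mono])
  have "st_map w ` set w \<subseteq> {1..length w}"
  proof clarify
    fix a assume a: "a \<in> set w"
    have "card {b \<in> set w. b \<le> a} \<le> card (set w)"
      by (intro card_mono) auto
    moreover have "card {b \<in> set w. b \<le> a} > 0"
      using a by (auto simp: card_gt_0_iff)
    ultimately show "st_map w a \<in> {1..length w}"
      using assms by (simp add: st_map_def distinct_card)
  qed
  moreover have "card (st_map w ` set w) = card {1..length w}"
    using card_image[OF inj] assms by (simp add: distinct_card)
  ultimately have "st_map w ` set w = {1..length w}"
    by (intro card_subset_eq) auto
  with inj show ?thesis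
    by (simp add: bij_betw_def)
qed

lemma st_in_perm_word:
  assumes "distinct w"
  shows "st w \<in> {w. distinct w \<and> set w = {1..length w}}"
  using st_map_bij[OF assms] assms by (auto simp: st_def distinct_map bij_betw_def)

definition mpr_mul :: "perm_word \<Rightarrow> perm_word \<Rightarrow> (perm_word \<Rightarrow>\<^sub>0 int)" where
  "mpr_mul p q =
     (let \<alpha> = Rep_perm_word p; \<beta> = Rep_perm_word q
      in (\<Sum>\<gamma>\<leftarrow>shuffle \<alpha> (map (\<lambda>b. length \<alpha> + b) \<beta>). frag_of (Abs_perm_word \<gamma>)))"

definition mpr_comul :: "perm_word \<Rightarrow> (perm_word \<times> perm_word \<Rightarrow>\<^sub>0 int)" where
  "mpr_comul p =
     (\<Sum>(u, v)\<in>cuts (Rep_perm_word p). frag_of (Abs_perm_word (st u), Abs_perm_word (st v)))"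

definition MPR :: "perm_word bialg" where
  "MPR = \<lparr>
     mul = frag_extend (\<lambda>(p, q). mpr_mul p q),
     unit = frag_of (Abs_perm_word []),
     comul = frag_extend mpr_comul,
     counit = (\<lambda>x. Poly_Mapping.lookup x (Abs_perm_word [])),
     deg = (\<lambda>p. length (Rep_perm_word p)) \<rparr>"

lemma mpr_mul_in_perm_word:
  assumes "\<gamma> \<in> set (shuffle (Rep_perm_word p) (map (\<lambda>b. length (Rep_perm_word p) + b) (Rep_perm_word q)))"
  shows "\<gamma> \<in> {w. distinct w \<and> set w = {1..length w}}"
proof -
  define \<alpha> \<beta> m n where defs: "\<alpha> = Rep_perm_word p" "\<beta> = Rep_perm_word q"
    "m = length \<alpha>" "n = length \<beta>"
  define \<beta>' where "\<beta>' = map (\<lambda>b. m + b) \<beta>"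
  have \<alpha>: "distinct \<alpha>" "set \<alpha> = {1..m}"
    using Rep_perm_word[of p] by (simp_all add: defs)
  have \<beta>: "distinct \<beta>" "set \<beta> = {1..n}"
    using Rep_perm_word[of q] by (simp_all add: defs)
  have \<gamma>: "\<gamma> \<in> shuffles \<alpha> \<beta>'"
    using assms by (simp add: set_shuffle defs \<beta>'_def)
  have \<beta>': "set \<beta>' = {m + 1..m + n}" "distinct \<beta>'" "length \<beta>' = n"
    using \<beta> by (simp_all add: \<beta>'_def distinct_map defs(4))
  have "set \<alpha> \<inter> set \<beta>' = {}"
    unfolding \<alpha>(2) \<beta>'(1) by simp
  then have "distinct \<gamma>"
    using distinct_disjoint_shuffles[OF \<alpha>(1) \<beta>'(2) _ \<gamma>] by simp
  moreover have "length \<gamma> = m + n"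
    using length_shuffles[OF \<gamma>] \<beta>'(3) by (simp add: defs(3))
  moreover have "set \<gamma> = {1..m + n}"
  proof -
    have "set \<gamma> = {1..m} \<union> {m + 1..m + n}"
      using set_shuffles[OF \<gamma>] unfolding \<alpha>(2) \<beta>'(1) .
    then show ?thesis
      by (simp add: set_eq_iff) linarith
  qed
  ultimately show ?thesis
    by simp
qed


section \<open>The Hopf algebra of double words\<close>

text \<open>The letter \<open>x\<^sub>i\<close> of the alphabet is encoded as the number \<open>i\<close>; as letters only matter up to
  renaming, the additional letter \<open>0\<close> yields no additional substitutions.\<close>

definition renaming :: "nat list \<times> nat list \<Rightarrow> nat list \<times> nat list \<Rightarrow> bool" where
  "renaming p q \<longleftrightarrow>
     set (fst p) = set (snd p) \<and> set (fst q) = set (snd q) \<and>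
     (\<exists>f. bij_betw f (set (fst p)) (set (fst q)) \<and> map f (fst p) = fst q \<and> map f (snd p) = snd q)"

lemma renaming_map:
  assumes "set \<rho> = set \<sigma>" "inj_on f (set \<rho>)"
  shows "renaming (\<rho>, \<sigma>) (map f \<rho>, map f \<sigma>)"
  using assms by (auto simp: renaming_def bij_betw_def)

quotient_type subst = "nat list \<times> nat list" / partial: renaming
proof (rule part_equivpI)
  show "\<exists>p. renaming p p"
    by (rule exI[of _ "([], [])"]) (auto simp: renaming_def bij_betw_def)
  show "symp renaming"
  proof (rule sympI)
    fix p q assume pq: "renaming p q"
    then obtain f where f: "bij_betw f (set (fst p)) (set (fst q))"
        "map f (fst p) = fst q" "map f (snd p) = snd q"
      by (auto simp: renaming_def)
    let ?g = "the_inv_into (set (fst p)) f"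
    have g: "?g (f x) = x" if "x \<in> set (fst p)" for x
      using the_inv_into_f_f[of f "set (fst p)" x] f(1) that by (simp add: bij_betw_def)
    have "bij_betw ?g (set (fst q)) (set (fst p))"
      by (rule bij_betw_the_inv_into[OF f(1)])
    moreover have "map ?g (fst q) = fst p" "map ?g (snd q) = snd p"
      using g pq by (auto simp: f(2,3)[symmetric] renaming_def intro!: map_idI)
    ultimately show "renaming q p"
      using pq by (auto simp: renaming_def)
  qed
  show "transp renaming"
  proof (rule transpI)
    fix p q r assume a: "renaming p q" "renaming q r"
    then obtain f g where "bij_betw f (set (fst p)) (set (fst q))"
        "map f (fst p) = fst q" "map f (snd p) = snd q"
        "bij_betw g (set (fst q)) (set (fst r))"
        "map g (fst q) = fst r" "map g (snd q) = snd r"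
      by (auto simp: renaming_def)
    then have "bij_betw (g \<circ> f) (set (fst p)) (set (fst r)) \<and>
        map (g \<circ> f) (fst p) = fst r \<and> map (g \<circ> f) (snd p) = snd r"
      using bij_betw_trans by (fastforce simp flip: map_map)
    with a show "renaming p r"
      by (auto simp: renaming_def)
  qed
qed

text \<open>The maps \<open>i \<mapsto> 2i\<close> and \<open>i \<mapsto> 2i + 1\<close> rename two substitutions to ones with disjoint
  supports; the lemmas below show that the operations do not depend on the representatives.\<close>

definition dwha_mul :: "subst \<Rightarrow> subst \<Rightarrow> (subst \<Rightarrow>\<^sub>0 int)" where
  "dwha_mul p q =
     (let (\<rho>, \<sigma>) = map_prod (map (\<lambda>i. 2 * i)) (map (\<lambda>i. 2 * i)) (rep_subst p);
          (\<rho>', \<sigma>') = map_prod (map (\<lambda>i. 2 * i + 1)) (map (\<lambda>i. 2 * i + 1)) (rep_subst q)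
      in (\<Sum>\<gamma>\<leftarrow>shuffle \<sigma> \<sigma>'. frag_of (abs_subst (\<rho> @ \<rho>', \<gamma>))))"

definition good_cuts :: "'a list \<Rightarrow> ('a list \<times> 'a list) set" where
  "good_cuts w = {(u, v) \<in> cuts w. set u \<inter> set v = {}}"

text \<open>The preimage \<open>p\<^sup>-\<^sup>1(\<tau>)\<close> in the upper word \<open>\<rho>\<close> of \<open>p\<close>.\<close>

definition preim :: "'a list \<Rightarrow> 'a list \<Rightarrow> 'a list" where
  "preim \<rho> \<tau> = filter (\<lambda>x. x \<in> set \<tau>) \<rho>"

definition dwha_comul :: "subst \<Rightarrow> (subst \<times> subst \<Rightarrow>\<^sub>0 int)" where
  "dwha_comul p =
     (let (\<rho>, \<sigma>) = rep_subst p
      in (\<Sum>(u, v)\<in>good_cuts \<sigma>. frag_of (abs_subst (preim \<rho> u, u), abs_subst (preim \<rho> v, v))))"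

definition dwha_deg :: "subst \<Rightarrow> nat" where
  "dwha_deg p = card (set (fst (rep_subst p)))"

definition dWHA :: "subst bialg" where
  "dWHA = \<lparr>
     mul = frag_extend (\<lambda>(p, q). dwha_mul p q),
     unit = frag_of (abs_subst ([], [])),
     comul = frag_extend dwha_comul,
     counit = (\<lambda>x. Poly_Mapping.lookup x (abs_subst ([], []))),
     deg = dwha_deg \<rparr>"

lemma abs_subst_eqI: "renaming p q \<Longrightarrow> abs_subst p = abs_subst q"
  using Quotient3_subst by (metis Quotient3_rel)

lemma rep_abs_subst:
  assumes "set \<rho> = set \<sigma>"
  obtains f where "inj_on f (set \<rho>)" "rep_subst (abs_subst (\<rho>, \<sigma>)) = (map f \<rho>, map f \<sigma>)"
proof -
  have "renaming (\<rho>, \<sigma>) (\<rho>, \<sigma>)"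
    using renaming_map[of \<rho> \<sigma> id] assms by simp
  then have "renaming (\<rho>, \<sigma>) (rep_subst (abs_subst (\<rho>, \<sigma>)))"
    using Quotient3_subst rep_abs_rsp by fastforce
  then show ?thesis
    using that by (auto simp: renaming_def bij_betw_def prod_eq_iff)
qed

lemma abs_subst_map:
  assumes "set \<rho> = set \<sigma>" "inj_on f (set \<rho>)"
  shows "abs_subst (map f \<rho>, map f \<sigma>) = abs_subst (\<rho>, \<sigma>)"
  using abs_subst_eqI[OF renaming_map[OF assms]] by simp

lemma dwha_mul_abs:
  assumes "set \<rho> = set \<sigma>" "set \<rho>' = set \<sigma>'" "set \<rho> \<inter> set \<rho>' = {}"
  shows "dwha_mul (abs_subst (\<rho>, \<sigma>)) (abs_subst (\<rho>', \<sigma>')) =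
    (\<Sum>\<gamma>\<leftarrow>shuffle \<sigma> \<sigma>'. frag_of (abs_subst (\<rho> @ \<rho>', \<gamma>)))"
proof -
  obtain f where f: "inj_on f (set \<rho>)" "rep_subst (abs_subst (\<rho>, \<sigma>)) = (map f \<rho>, map f \<sigma>)"
    using rep_abs_subst[OF assms(1)] .
  obtain f' where f': "inj_on f' (set \<rho>')"
      "rep_subst (abs_subst (\<rho>', \<sigma>')) = (map f' \<rho>', map f' \<sigma>')"
    using rep_abs_subst[OF assms(2)] .
  define g where "g = (\<lambda>x. if x \<in> set \<rho> then 2 * f x else 2 * f' x + 1)"
  have notin: "x \<notin> set \<rho>" if "x \<in> set \<rho>'" for x
    using assms(3) that by auto
  have g1: "map (\<lambda>i. 2 * i) (map f \<rho>) = map g \<rho>" "map (\<lambda>i. 2 * i) (map f \<sigma>) = map g \<sigma>"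
    using assms(1) by (auto simp: g_def)
  have g2: "map (\<lambda>i. 2 * i + 1) (map f' \<rho>') = map g \<rho>'"
      "map (\<lambda>i. 2 * i + 1) (map f' \<sigma>') = map g \<sigma>'"
    using assms(2) notin by (auto simp: g_def)
  have parity: "2 * i \<noteq> 2 * j + 1" "2 * j + 1 \<noteq> 2 * i" for i j :: nat
    by presburger+
  have inj: "inj_on g (set (\<rho> @ \<rho>'))"
    using f(1) f'(1) parity by (auto simp: g_def inj_on_def split: if_splits)
  have "dwha_mul (abs_subst (\<rho>, \<sigma>)) (abs_subst (\<rho>', \<sigma>')) =
      (\<Sum>\<gamma>\<leftarrow>shuffle (map g \<sigma>) (map g \<sigma>'). frag_of (abs_subst (map g \<rho> @ map g \<rho>', \<gamma>)))"
    unfolding dwha_mul_def f(2) f'(2) map_prod_simp g1 g2 by simp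
  also have "\<dots> = (\<Sum>\<gamma>\<leftarrow>shuffle \<sigma> \<sigma>'. frag_of (abs_subst (map g (\<rho> @ \<rho>'), map g \<gamma>)))"
    by (simp add: shuffle_map comp_def)
  also have "\<dots> = (\<Sum>\<gamma>\<leftarrow>shuffle \<sigma> \<sigma>'. frag_of (abs_subst (\<rho> @ \<rho>', \<gamma>)))"
  proof (intro arg_cong[where f = sum_list] map_cong refl)
    fix \<gamma> assume "\<gamma> \<in> set (shuffle \<sigma> \<sigma>')"
    then have "set (\<rho> @ \<rho>') = set \<gamma>"
      using assms(1,2) set_shuffles[of \<gamma> \<sigma> \<sigma>'] by (simp add: set_shuffle)
    then show "frag_of (abs_subst (map g (\<rho> @ \<rho>'), map g \<gamma>)) = frag_of (abs_subst (\<rho> @ \<rho>', \<gamma>))"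
      using abs_subst_map[OF _ inj] by simp
  qed
  finally show ?thesis .
qed

lemma good_cuts_map:
  assumes "inj_on f (set w)"
  shows "good_cuts (map f w) = map_prod (map f) (map f) ` good_cuts w"
proof -
  have "set (map f (take k w)) \<inter> set (map f (drop k w)) = {} \<longleftrightarrow>
      set (take k w) \<inter> set (drop k w) = {}" for k
    using inj_on_image_Int[OF assms set_take_subset set_drop_subset, of k k]
    by (metis image_is_empty set_map)
  then show ?thesis
    unfolding good_cuts_def cuts_eq
    by (auto simp: take_map drop_map image_iff simp del: set_map)
qed

lemma dwha_comul_abs:
  assumes "set \<rho> = set \<sigma>"
  shows "dwha_comul (abs_subst (\<rho>, \<sigma>)) =
    (\<Sum>(u, v)\<in>good_cuts \<sigma>. frag_of (abs_subst (preim \<rho> u, u), abs_subst (preim \<rho> v, v)))"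
proof -
  obtain f where f: "inj_on f (set \<rho>)" "rep_subst (abs_subst (\<rho>, \<sigma>)) = (map f \<rho>, map f \<sigma>)"
    using rep_abs_subst[OF assms] .
  have sub: "set u \<subseteq> set \<rho>" "set v \<subseteq> set \<rho>" if "(u, v) \<in> good_cuts \<sigma>" for u v
    using that assms by (auto simp: good_cuts_def cuts_def)
  have pre: "abs_subst (preim (map f \<rho>) (map f u), map f u) = abs_subst (preim \<rho> u, u)"
    if "set u \<subseteq> set \<rho>" for u
  proof -
    have "preim (map f \<rho>) (map f u) = map f (preim \<rho> u)"
      using that f(1) unfolding preim_def filter_map
      by (auto simp: inj_on_image_mem_iff intro!: arg_cong[where f = "map f"] filter_cong)
    moreover have "set (preim \<rho> u) = set u"
      using that by (auto simp: preim_def)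
    ultimately show ?thesis
      using abs_subst_map[of "preim \<rho> u" u f] inj_on_subset[OF f(1) that] by simp
  qed
  have inj: "inj_on (map_prod (map f) (map f)) (good_cuts \<sigma>)"
  proof (rule inj_onI, clarify)
    fix u v u' v'
    assume *: "(u, v) \<in> good_cuts \<sigma>" "(u', v') \<in> good_cuts \<sigma>"
      "map_prod (map f) (map f) (u, v) = map_prod (map f) (map f) (u', v')"
    then have "length u = length u'" "u @ v = u' @ v'"
      by (auto simp: good_cuts_def cuts_def dest: map_eq_imp_length_eq)
    then show "u = u' \<and> v = v'"
      by simp
  qed
  have "dwha_comul (abs_subst (\<rho>, \<sigma>)) = (\<Sum>(u, v)\<in>good_cuts (map f \<sigma>).
      frag_of (abs_subst (preim (map f \<rho>) u, u), abs_subst (preim (map f \<rho>) v, v)))"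
    by (simp add: dwha_comul_def f(2))
  also have "\<dots> = (\<Sum>(u, v)\<in>good_cuts \<sigma>.
      frag_of (abs_subst (preim (map f \<rho>) (map f u), map f u), abs_subst (preim (map f \<rho>) (map f v), map f v)))"
    using f(1) assms by (simp add: good_cuts_map sum.reindex[OF inj] case_prod_unfold)
  also have "\<dots> = (\<Sum>(u, v)\<in>good_cuts \<sigma>. frag_of (abs_subst (preim \<rho> u, u), abs_subst (preim \<rho> v, v)))"
    using sub pre by (intro sum.cong refl) auto
  finally show ?thesis .
qed

lemma dwha_deg_abs:
  assumes "set \<rho> = set \<sigma>"
  shows "dwha_deg (abs_subst (\<rho>, \<sigma>)) = card (set \<rho>)"
proof -
  obtain f where "inj_on f (set \<rho>)" "rep_subst (abs_subst (\<rho>, \<sigma>)) = (map f \<rho>, map f \<sigma>)"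
    using rep_abs_subst[OF assms] .
  then show ?thesis
    by (simp add: dwha_deg_def card_image)
qed


section \<open>The map from permutations to substitutions\<close>

definition phi :: "(perm_word \<Rightarrow>\<^sub>0 int) \<Rightarrow> (subst \<Rightarrow>\<^sub>0 int)" where
  "phi = frag_extend
     (\<lambda>p. let t = Rep_perm_word p in frag_of (abs_subst ([1..<length t + 1], t)))"

end

theory Submission
  imports Defs
begin

text \<open>
  The map \<open>phi\<close> is induced by an injection of bases. Hence it suffices to prove that double words
  form a connected graded bialgebra and that \<open>phi\<close> respects all operations: the bialgebra axioms
  for permutations are then pulled back along \<open>phi\<close> and its injective tensor powers.

  A connected graded bialgebra has an antipode: \<open>\<eta>\<epsilon> - id\<close> vanishes in degree \<open>0\<close>, so its \<open>n\<close>-th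
  convolution power vanishes in degrees below \<open>n\<close>, and the geometric series of \<open>\<eta>\<epsilon> - id\<close> is a
  well-defined convolution inverse of \<open>id\<close>. Bialgebra morphisms commute with antipodes because both
  \<open>f \<circ> S\<close> and \<open>S \<circ> f\<close> are convolution inverses of \<open>f\<close>.

  For double words, the compatibility of product and coproduct is the statement that cutting a
  shuffle of two words amounts to cutting both words and shuffling the left and the right parts;
  the cut is good iff both cuts are, since the words have disjoint supports.
\<close>

section \<open>Tensor products of free Abelian groups\<close>

text \<open>Basis elements generate the group and differences already supply negatives, so an
  identity compatible with 0 and \<open>-\<close> may be checked on the basis. Nearly every linear
  identity below is proved this way.\<close>

lemma frag_induct [case_names zero of diff]:
  assumes "P 0" "\<And>b. P (frag_of b)" "\<And>x y. P x \<Longrightarrow> P y \<Longrightarrow> P (x - y)"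
  shows "P (x :: 'b \<Rightarrow>\<^sub>0 int)"
  by (rule frag_induction[of x UNIV]) (use assms in auto)

lemma additive_simps:
  assumes "additive f"
  shows "f 0 = 0" "f (x - y) = f x - f y" "f (x + y) = f x + f y"
    "f (sum h A) = (\<Sum>a\<in>A. f (h a))" "f (\<Sum>x\<leftarrow>xs. k x) = (\<Sum>x\<leftarrow>xs. f (k x))"
proof -
  interpret additive f by fact
  show "f 0 = 0" "f (x - y) = f x - f y" "f (x + y) = f x + f y"
    "f (sum h A) = (\<Sum>a\<in>A. f (h a))"
    by (simp_all add: zero diff add sum)
  show "f (\<Sum>x\<leftarrow>xs. k x) = (\<Sum>x\<leftarrow>xs. f (k x))"
    by (induction xs) (simp_all add: zero add)
qed

lemma additive_diffI:
  assumes "\<And>x y. f (x - y) = f x - f y"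
  shows "additive f"
proof
  fix x y
  show "f (x + y) = f x + f y"
    using assms[of x "0 - y"] assms[of 0 y] assms[of 0 0] by simp
qed

lemma additive_cmul:
  fixes f :: "('a \<Rightarrow>\<^sub>0 int) \<Rightarrow> ('b \<Rightarrow>\<^sub>0 int)"
  assumes "additive f"
  shows "f (frag_cmul k x) = frag_cmul k (f x)"
  by (induction k rule: int_induct[where k = 0])
    (simp_all add: additive_simps[OF assms] frag_cmul_distrib frag_cmul_diff_distrib)

lemma additive_ext:
  assumes "additive f" "additive g" "\<And>b. f (frag_of b) = g (frag_of b)"
  shows "f x = g x"
  by (induction x rule: frag_induct) (simp_all add: assms additive_simps)

lemma additive_frag_extend: "additive (frag_extend f)"
  by (intro additive_diffI frag_extend_diff)

text \<open>The outer \<open>frag_extend\<close> gives linearity in the first argument at once; the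
  second argument sits under a binder, which calls for induction on \<open>x\<close>.\<close>

lemma tens_simps [simp]:
  "tens 0 y = 0" "tens x 0 = 0"
  "tens (x - x') y = tens x y - tens x' y" "tens x (y - y') = tens x y - tens x y'"
  "tens (frag_of a) (frag_of b) = frag_of (a, b)"
proof -
  show "tens x (y - y') = tens x y - tens x y'"
    by (induction x rule: frag_induct) (simp_all add: tens_def frag_extend_diff algebra_simps)
  show "tens x 0 = 0"
    by (induction x rule: frag_induct) (simp_all add: tens_def frag_extend_diff)
qed (simp_all add: tens_def frag_extend_diff)

lemma additive_tens: "additive (\<lambda>x. tens x y)" "additive (tens x)"
  by (simp_all add: additive_diffI)

lemmas tens_sum = additive_simps(4)[OF additive_tens(1)] additive_simps(4)[OF additive_tens(2)]

lemmas tens_cmul = additive_cmul[OF additive_tens(1)] additive_cmul[OF additive_tens(2)]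

lemma tens_map_simps [simp]:
  "tens_map f g 0 = 0" "tens_map f g (x - y) = tens_map f g x - tens_map f g y"
  "tens_map f g (frag_of (a, b)) = tens (f (frag_of a)) (g (frag_of b))"
  by (simp_all add: tens_map_def frag_extend_diff)

lemma additive_tens_map: "additive (tens_map f g)"
  by (simp add: additive_diffI)

lemma tens_map_tens:
  assumes "additive f" "additive g"
  shows "tens_map f g (tens x y) = tens (f x) (g y)"
proof (induction x rule: frag_induct)
  case (of a)
  show ?case
    by (induction y rule: frag_induct) (simp_all add: assms additive_simps)
qed (simp_all add: assms additive_simps)

text \<open>Only the basis pairs that occur in \<open>u\<close> matter. This later allows the
  antipode to be exchanged for a truncated series on a coproduct of bounded degree.\<close>

lemma tens_map_cong:
  assumes "\<And>a b. (a, b) \<in> Poly_Mapping.keys u \<Longrightarrow> f (frag_of a) = f' (frag_of a)"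
    and "\<And>a b. (a, b) \<in> Poly_Mapping.keys u \<Longrightarrow> g (frag_of b) = g' (frag_of b)"
  shows "tens_map f g u = tens_map f' g' u"
  unfolding tens_map_def using assms by (intro frag_extend_eq) auto

text \<open>The inner maps are evaluated on basis elements, while the outer maps meet arbitrary
  values of these; hence additivity of the outer pair.\<close>

lemma tens_map_comp:
  assumes "additive f" "additive g"
  shows "tens_map f g (tens_map f' g' u) = tens_map (f \<circ> f') (g \<circ> g') u"
proof (induction u rule: frag_induct)
  case (of b)
  then show ?case by (cases b) (simp add: tens_map_tens assms)
qed simp_all

lemma keys_tens: "Poly_Mapping.keys (tens x y) \<subseteq> Poly_Mapping.keys x \<times> Poly_Mapping.keys y"
proof -
  have "Poly_Mapping.keys (frag_extend (\<lambda>b. frag_of (a, b)) y) \<subseteq> {a} \<times> Poly_Mapping.keys y" for a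
    using keys_frag_extend[of "\<lambda>b. frag_of (a, b)" y] by auto
  then show ?thesis
    using keys_frag_extend[of "\<lambda>a. frag_extend (\<lambda>b. frag_of (a, b)) y" x] unfolding tens_def by fast
qed

lemma tens_assoc_simps [simp]:
  "tens_assoc 0 = 0" "tens_assoc (x - y) = tens_assoc x - tens_assoc y"
  "tens_assoc (frag_of ((a, b), c)) = frag_of (a, b, c)"
  by (simp_all add: tens_assoc_def frag_extend_diff)

lemma additive_tens_assoc: "additive tens_assoc"
  by (simp add: additive_diffI)

lemma tens_assoc_tens: "tens_assoc (tens (tens x y) z) = tens x (tens y z)"
proof (induction x rule: frag_induct)
  case (of a)
  show ?case
  proof (induction y rule: frag_induct)
    case (of b)
    show ?case
      by (induction z rule: frag_induct) simp_all
  qed simp_all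
qed simp_all


section \<open>Convolution\<close>

text \<open>The convolution product of maps from a coalgebra \<open>C\<close> to an algebra
  \<open>A\<close>. Keeping the two apart puts a morphism and its composites with both antipodes
  into one monoid.\<close>

definition conv :: "'a bialg \<Rightarrow> 'b bialg \<Rightarrow> (('a \<Rightarrow>\<^sub>0 int) \<Rightarrow> ('b \<Rightarrow>\<^sub>0 int)) \<Rightarrow>
    (('a \<Rightarrow>\<^sub>0 int) \<Rightarrow> ('b \<Rightarrow>\<^sub>0 int)) \<Rightarrow> ('a \<Rightarrow>\<^sub>0 int) \<Rightarrow> ('b \<Rightarrow>\<^sub>0 int)" where
  "conv C A f g x = mul A (tens_map f g (comul C x))"

definition conv_one :: "'a bialg \<Rightarrow> 'b bialg \<Rightarrow> ('a \<Rightarrow>\<^sub>0 int) \<Rightarrow> ('b \<Rightarrow>\<^sub>0 int)" where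
  "conv_one C A x = frag_cmul (counit C x) (unit A)"

lemma is_antipode_iff_conv:
  "is_antipode H S \<longleftrightarrow> additive S \<and> conv H H S id = conv_one H H \<and> conv H H id S = conv_one H H"
  by (auto simp: is_antipode_def conv_def conv_one_def fun_eq_iff)

context
  fixes C :: "'a bialg" and A :: "'b bialg"
  assumes C: "is_coalgebra C" and A: "is_algebra A"
begin

lemma mul_additive: "additive (mul A)" and comul_additive: "additive (comul C)"
  and counit_additive: "additive (counit C)"
  using A C by (auto simp: is_algebra_def is_coalgebra_def)

lemma additive_conv: "additive (conv C A f g)"
  by (rule additive_diffI) (simp add: conv_def mul_additive comul_additive additive_simps)

lemma additive_conv_one: "additive (conv_one C A)"
  by (rule additive_diffI)
    (simp add: conv_one_def counit_additive additive_simps frag_cmul_diff_distrib)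

text \<open>Counit axiom of \<open>C\<close> and unit axiom of \<open>A\<close>. The inner claim is
  about an arbitrary tensor \<open>u\<close>, so that linearity reduces it to basis pairs before the
  coproduct is inserted.\<close>

lemma conv_one_left:
  assumes "additive f"
  shows "conv C A (conv_one C A) f = f"
proof
  fix x
  have "mul A (tens_map (conv_one C A) f u) =
      f (frag_extend (\<lambda>(a, b). frag_cmul (counit C (frag_of a)) (frag_of b)) u)" for u
  proof (induction u rule: frag_induct)
    case (of p)
    then show ?case
      using A by (cases p) (simp add: conv_one_def tens_cmul additive_cmul[OF mul_additive]
        additive_cmul[OF assms] is_algebra_def)
  qed (simp_all add: additive_simps mul_additive assms frag_extend_diff)
  then show "conv C A (conv_one C A) f x = f x"
    using C by (simp add: conv_def is_coalgebra_def)
qed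

lemma conv_one_right:
  assumes "additive f"
  shows "conv C A f (conv_one C A) = f"
proof
  fix x
  have "mul A (tens_map f (conv_one C A) u) =
      f (frag_extend (\<lambda>(a, b). frag_cmul (counit C (frag_of b)) (frag_of a)) u)" for u
  proof (induction u rule: frag_induct)
    case (of p)
    then show ?case
      using A by (cases p) (simp add: conv_one_def tens_cmul additive_cmul[OF mul_additive]
        additive_cmul[OF assms] is_algebra_def)
  qed (simp_all add: additive_simps mul_additive assms frag_extend_diff)
  then show "conv C A f (conv_one C A) x = f x"
    using C by (simp add: conv_def is_coalgebra_def)
qed

text \<open>\<open>T\<close> is the threefold product f(a)(g(b)h(c)) on the triple tensor product.
  Associativity of \<open>A\<close> writes the left side as \<open>T\<close> after comul \<otimes>
  id and reassociation; the right side is \<open>T\<close> after id \<otimes> comul. Coassociativity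
  of \<open>C\<close> joins the two.\<close>

lemma conv_assoc: "conv C A (conv C A f g) h = conv C A f (conv C A g h)"
proof
  fix x
  define T where "T = frag_extend (\<lambda>(a, b, c).
    mul A (tens (f (frag_of a)) (mul A (tens (g (frag_of b)) (h (frag_of c))))))"
  have T: "T 0 = 0" "T (u - v) = T u - T v"
    "T (frag_of (a, b, c)) = mul A (tens (f (frag_of a)) (mul A (tens (g (frag_of b)) (h (frag_of c)))))"
    for u v a b c
    by (simp_all add: T_def frag_extend_diff)
  note additive = additive_simps mul_additive comul_additive T
  have left_basis: "mul A (tens (mul A (tens_map f g v)) (h (frag_of c))) =
      T (tens_assoc (tens v (frag_of c)))" for v c
  proof (induction v rule: frag_induct)
    case (of p)
    then show ?case
      using A by (cases p) (simp add: T is_algebra_def)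
  qed (simp_all add: additive)
  have left: "mul A (tens_map (conv C A f g) h u) = T (tens_assoc (tens_map (comul C) id u))" for u
  proof (induction u rule: frag_induct)
    case (of p)
    then show ?case
      using left_basis by (cases p) (simp add: conv_def)
  qed (simp_all add: additive)
  have right_basis: "mul A (tens (f (frag_of a)) (mul A (tens_map g h v))) =
      T (tens (frag_of a) v)" for v a
  proof (induction v rule: frag_induct)
    case (of p)
    then show ?case
      by (cases p) (simp add: T)
  qed (simp_all add: additive)
  have right: "mul A (tens_map f (conv C A g h) u) = T (tens_map id (comul C) u)" for u
  proof (induction u rule: frag_induct)
    case (of p)
    then show ?case
      using right_basis by (cases p) (simp add: conv_def)
  qed (simp_all add: additive)
  show "conv C A (conv C A f g) h x = conv C A f (conv C A g h) x"
    using C left right by (simp add: conv_def[of _ _ _ h] conv_def[of _ _ f] is_coalgebra_def)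
qed

text \<open>The monoid argument g = g(fh) = (gf)h = h; \<open>conv_one\<close> is neutral for the
  additive maps \<open>g\<close> and \<open>h\<close>.\<close>

lemma conv_inverse_unique:
  assumes "additive g" "additive h"
    and "conv C A g f = conv_one C A" "conv C A f h = conv_one C A"
  shows "g = h"
  by (metis assms conv_assoc conv_one_left conv_one_right)

text \<open>This and the next three lemmas are bilinearity of convolution in the shapes met by the
  geometric series: \<open>id\<close> is a difference and the partial sums are finite sums.\<close>

lemma conv_diff_left: "conv C A (\<lambda>x. f x - f' x) g x = conv C A f g x - conv C A f' g x"
proof -
  have "tens_map (\<lambda>x. f x - f' x) g u = tens_map f g u - tens_map f' g u" for u
  proof (induction u rule: frag_induct)
    case (of p)
    then show ?case by (cases p) simp
  qed (simp_all)
  then show ?thesis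
    by (simp add: conv_def mul_additive additive_simps)
qed

lemma conv_diff_right: "conv C A g (\<lambda>x. f x - f' x) x = conv C A g f x - conv C A g f' x"
proof -
  have "tens_map g (\<lambda>x. f x - f' x) u = tens_map g f u - tens_map g f' u" for u
  proof (induction u rule: frag_induct)
    case (of p)
    then show ?case by (cases p) simp
  qed (simp_all)
  then show ?thesis
    by (simp add: conv_def mul_additive additive_simps)
qed

lemma conv_sum_left: "conv C A (\<lambda>x. \<Sum>i\<in>I. f i x) g x = (\<Sum>i\<in>I. conv C A (f i) g x)"
proof -
  have "tens_map (\<lambda>x. \<Sum>i\<in>I. f i x) g u = (\<Sum>i\<in>I. tens_map (f i) g u)" for u
  proof (induction u rule: frag_induct)
    case (of p)
    then show ?case by (cases p) (simp add: tens_sum)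
  qed (simp_all add: sum_subtractf)
  then show ?thesis
    by (simp add: conv_def mul_additive additive_simps)
qed

lemma conv_sum_right: "conv C A g (\<lambda>x. \<Sum>i\<in>I. f i x) x = (\<Sum>i\<in>I. conv C A g (f i) x)"
proof -
  have "tens_map g (\<lambda>x. \<Sum>i\<in>I. f i x) u = (\<Sum>i\<in>I. tens_map g (f i) u)" for u
  proof (induction u rule: frag_induct)
    case (of p)
    then show ?case by (cases p) (simp add: tens_sum)
  qed (simp_all add: sum_subtractf)
  then show ?thesis
    by (simp add: conv_def mul_additive additive_simps)
qed

end

lemma bialgebra_hom_antipode:
  assumes "is_hopf_algebra H" "is_hopf_algebra K" and f: "additive f"
    and mul: "\<And>x y. f (mul H (tens x y)) = mul K (tens (f x) (f y))"
    and unit: "f (unit H) = unit K"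
    and comul: "\<And>x. comul K (f x) = tens_map f f (comul H x)"
    and counit: "\<And>x. counit K (f x) = counit H x"
  shows "f (antipode H x) = antipode K (f x)"
proof -
  have H: "is_coalgebra H" "is_algebra H" and K: "is_coalgebra K" "is_algebra K"
    using assms(1,2) by (auto simp: is_hopf_algebra_def is_bialgebra_def)
  note additive = additive_simps f mul_additive[OF H] mul_additive[OF K]
  have "is_antipode H (antipode H)" "is_antipode K (antipode K)"
    using assms(1,2) theI'[of "is_antipode H"] theI'[of "is_antipode K"]
    by (simp_all add: is_hopf_algebra_def antipode_def)
  then have SH: "additive (antipode H)" "conv H H (antipode H) id = conv_one H H"
    and SK: "additive (antipode K)" "conv K K id (antipode K) = conv_one K K"
    by (auto simp: is_antipode_iff_conv)
  \<comment> \<open>Left inverse: here \<open>f\<close> acts as a morphism of unital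
    algebras.\<close>
  have "f (mul H (tens_map (antipode H) id u)) = mul K (tens_map (f \<circ> antipode H) f u)" for u
  proof (induction u rule: frag_induct)
    case (of p)
    then show ?case by (cases p) (simp add: mul)
  qed (simp_all add: additive)
  then have "conv H K (f \<circ> antipode H) f x = f (conv H H (antipode H) id x)" for x
    by (simp add: conv_def)
  then have 1: "conv H K (f \<circ> antipode H) f = conv_one H K"
    by (simp add: fun_eq_iff SH conv_one_def additive_cmul[OF f] unit)
  \<comment> \<open>Right inverse: here \<open>f\<close> acts as a morphism of coalgebras.\<close>
  have "conv H K f (antipode K \<circ> f) x = conv K K id (antipode K) (f x)" for x
    using tens_map_comp[of id "antipode K" f f] SK(1)
    by (simp add: conv_def comul additive_diffI)
  then have 2: "conv H K f (antipode K \<circ> f) = conv_one H K"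
    by (simp add: fun_eq_iff SK conv_one_def counit)
  have "additive (f \<circ> antipode H)" "additive (antipode K \<circ> f)"
    by (simp_all add: additive_diffI additive_simps f SH SK)
  from conv_inverse_unique[OF H(1) K(2) this 1 2] show ?thesis
    by (simp add: fun_eq_iff)
qed


section \<open>Antipodes of connected graded bialgebras\<close>

text \<open>All requirements of \<open>is_connected_graded_hopf_algebra\<close> except those on the
  antipode, which are derived inside the locale.\<close>

locale connected_graded_bialgebra =
  fixes H :: "'b bialg"
  assumes bialgebra: "is_bialgebra H"
    and mul_graded: "u \<in> hcomp2 H n \<Longrightarrow> mul H u \<in> hcomp H n"
    and unit_graded: "unit H \<in> hcomp H 0"
    and comul_graded: "x \<in> hcomp H n \<Longrightarrow> comul H x \<in> hcomp2 H n"
    and counit_graded: "x \<in> hcomp H n \<Longrightarrow> n > 0 \<Longrightarrow> counit H x = 0"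
    and connected: "bij_betw (\<lambda>k. frag_cmul k (unit H)) UNIV (hcomp H 0)"
begin

lemma coalgebra: "is_coalgebra H" and algebra: "is_algebra H"
  using bialgebra by (auto simp: is_bialgebra_def)

lemma frag_of_hcomp_iff [simp]: "frag_of b \<in> hcomp H n \<longleftrightarrow> deg H b = n"
  by (simp add: hcomp_def)

lemma hcomp_diff: "x \<in> hcomp H n \<Longrightarrow> y \<in> hcomp H n \<Longrightarrow> x - y \<in> hcomp H n"
  using keys_diff[of x y] by (auto simp: hcomp_def)

lemma hcomp_sum: "(\<And>i. i \<in> I \<Longrightarrow> f i \<in> hcomp H n) \<Longrightarrow> sum f I \<in> hcomp H n"
  using keys_sum[of f I] by (fastforce simp: hcomp_def)

section \<open>Convolution of degree-preserving maps\<close>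

lemma tens_map_graded:
  assumes "u \<in> hcomp2 H n"
    and "\<And>n x. x \<in> hcomp H n \<Longrightarrow> f x \<in> hcomp H n" "\<And>n x. x \<in> hcomp H n \<Longrightarrow> g x \<in> hcomp H n"
  shows "tens_map f g u \<in> hcomp2 H n"
proof -
  have "deg H a' + deg H b' = n"
    if "(a, b) \<in> Poly_Mapping.keys u"
      "(a', b') \<in> Poly_Mapping.keys (tens (f (frag_of a)) (g (frag_of b)))" for a b a' b'
  proof -
    have "f (frag_of a) \<in> hcomp H (deg H a)" "g (frag_of b) \<in> hcomp H (deg H b)"
      by (simp_all add: assms(2,3))
    moreover have "a' \<in> Poly_Mapping.keys (f (frag_of a))" "b' \<in> Poly_Mapping.keys (g (frag_of b))"
      using that(2) keys_tens by fastforce+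
    moreover have "deg H a + deg H b = n"
      using assms(1) that(1) by (auto simp: hcomp2_def)
    ultimately show ?thesis
      by (auto simp: hcomp_def)
  qed
  then show ?thesis
    using keys_frag_extend[of "\<lambda>(a, b). tens (f (frag_of a)) (g (frag_of b))" u]
    unfolding hcomp2_def tens_map_def by fastforce
qed

lemma conv_graded:
  assumes "x \<in> hcomp H n"
    and "\<And>n x. x \<in> hcomp H n \<Longrightarrow> f x \<in> hcomp H n" "\<And>n x. x \<in> hcomp H n \<Longrightarrow> g x \<in> hcomp H n"
  shows "conv H H f g x \<in> hcomp H n"
  unfolding conv_def by (intro mul_graded tens_map_graded comul_graded assms)

text \<open>In positive degree the counit vanishes; in degree 0 the value is a multiple of the
  unit.\<close>

lemma conv_one_graded: "x \<in> hcomp H n \<Longrightarrow> conv_one H H x \<in> hcomp H n"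
  using counit_graded[of x n] unit_graded by (cases "n = 0") (auto simp: conv_one_def hcomp_def)

text \<open>Up to sign the projection onto the kernel of the counit. The sign makes
  \<open>id\<close> equal to \<open>conv_one\<close> minus \<open>aug\<close>, which the geometric
  series in \<open>aug\<close> inverts.\<close>

definition aug :: "('b \<Rightarrow>\<^sub>0 int) \<Rightarrow> ('b \<Rightarrow>\<^sub>0 int)" where
  "aug x = conv_one H H x - x"

lemma additive_aug: "additive aug"
  by (rule additive_diffI)
    (simp add: aug_def additive_simps additive_conv_one[OF coalgebra algebra] algebra_simps)

lemma aug_graded: "x \<in> hcomp H n \<Longrightarrow> aug x \<in> hcomp H n"
  unfolding aug_def by (intro hcomp_diff conv_one_graded)

lemma aug_degree_zero:
  assumes "x \<in> hcomp H 0"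
  shows "aug x = 0"
proof -
  obtain k where k: "x = frag_cmul k (unit H)"
    using connected assms by (auto simp: bij_betw_def)
  have "additive (counit H)" "counit H (unit H) = 1"
    using bialgebra by (auto simp: is_bialgebra_def is_coalgebra_def)
  \<comment> \<open>\<open>additive_cmul\<close> is about maps between free Abelian groups; the
    counit has integer values, so the induction is repeated for it.\<close>
  moreover from this(1) have "counit H (frag_cmul k y) = k * counit H y" for y
    by (induction k rule: int_induct[where k = 0])
      (simp_all add: additive_simps frag_cmul_distrib frag_cmul_diff_distrib algebra_simps)
  ultimately show ?thesis
    by (simp add: aug_def conv_one_def k)
qed

primrec aug_pow :: "nat \<Rightarrow> ('b \<Rightarrow>\<^sub>0 int) \<Rightarrow> ('b \<Rightarrow>\<^sub>0 int)" where
  "aug_pow 0 = conv_one H H"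
| "aug_pow (Suc n) = conv H H aug (aug_pow n)"

lemma additive_aug_pow: "additive (aug_pow n)"
  by (cases n) (simp_all add: additive_conv additive_conv_one coalgebra algebra)

lemma aug_pow_graded: "x \<in> hcomp H n \<Longrightarrow> aug_pow k x \<in> hcomp H n"
  by (induction k arbitrary: x n) (auto intro: conv_one_graded conv_graded aug_graded)

text \<open>The recursion splits off a factor on the left; splitting it off on the right as well
  makes the series a two-sided inverse.\<close>

lemma aug_pow_commute: "conv H H (aug_pow n) aug = aug_pow (Suc n)"
proof (induction n)
  case 0
  then show ?case
    by (simp add: conv_one_left conv_one_right additive_aug coalgebra algebra)
next
  case (Suc n)
  then show ?case
    by (simp add: conv_assoc[OF coalgebra algebra])
qed

text \<open>In a term a \<otimes> b of the coproduct the degrees add up to n. Either a has degree 0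
  and is killed by \<open>aug\<close>, or b has degree below k and is killed by the induction
  hypothesis.\<close>

lemma aug_pow_eq_0: "x \<in> hcomp H n \<Longrightarrow> n < k \<Longrightarrow> aug_pow k x = 0"
proof (induction k arbitrary: x n)
  case (Suc k)
  have "tens (aug (frag_of a)) (aug_pow k (frag_of b)) = 0"
    if "(a, b) \<in> Poly_Mapping.keys (comul H x)" for a b
  proof -
    have "deg H a + deg H b = n"
      using comul_graded[OF Suc.prems(1)] that by (auto simp: hcomp2_def)
    then have "deg H a = 0 \<or> deg H b < k"
      using Suc.prems(2) by linarith
    then show ?thesis
      using aug_degree_zero Suc.IH by fastforce
  qed
  then have "tens_map aug (aug_pow k) (comul H x) = 0"
    unfolding tens_map_def by (intro frag_extend_eq_0) auto
  then show ?case
    using mul_additive[OF coalgebra algebra] by (simp add: conv_def additive_simps)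
qed simp

definition aug_sum :: "nat \<Rightarrow> ('b \<Rightarrow>\<^sub>0 int) \<Rightarrow> ('b \<Rightarrow>\<^sub>0 int)" where
  "aug_sum N x = (\<Sum>k\<le>N. aug_pow k x)"

text \<open>The geometric series, cut off on each basis element at its degree, beyond which all
  powers vanish.\<close>

definition S :: "('b \<Rightarrow>\<^sub>0 int) \<Rightarrow> ('b \<Rightarrow>\<^sub>0 int)" where
  "S = frag_extend (\<lambda>b. aug_sum (deg H b) (frag_of b))"

text \<open>Any later cut-off gives the same value, so a single \<open>N\<close> can serve all
  factors of a coproduct.\<close>

lemma S_frag_of:
  assumes "deg H b \<le> N"
  shows "S (frag_of b) = aug_sum N (frag_of b)"
proof -
  have "(\<Sum>k\<le>deg H b. aug_pow k (frag_of b)) = (\<Sum>k\<le>N. aug_pow k (frag_of b))"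
    using assms by (intro sum.mono_neutral_left) (auto intro: aug_pow_eq_0)
  then show ?thesis
    by (simp add: S_def aug_sum_def)
qed

lemma S_graded:
  assumes "x \<in> hcomp H n"
  shows "S x \<in> hcomp H n"
proof -
  have "Poly_Mapping.keys (S x) \<subseteq> (\<Union>b\<in>Poly_Mapping.keys x. Poly_Mapping.keys (S (frag_of b)))"
    using keys_frag_extend[of _ x] by (simp add: S_def)
  moreover have "S (frag_of b) \<in> hcomp H (deg H b)" for b
    unfolding S_frag_of[OF order.refl] aug_sum_def by (intro hcomp_sum aug_pow_graded) simp
  ultimately show ?thesis
    using assms by (fastforce simp: hcomp_def)
qed

text \<open>The telescoping identity (1 - a)(1 + a + ... + a^N) = 1 - a^(N+1), with
  \<open>aug\<close> as a and on both sides. The powers \<open>aug_pow (Suc k)\<close> stay folded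
  so that \<open>sum_telescope\<close> matches.\<close>

lemma conv_id_aug_sum:
  "conv H H id (aug_sum N) x = conv_one H H x - aug_pow (Suc N) x"
  "conv H H (aug_sum N) id x = conv_one H H x - aug_pow (Suc N) x"
proof -
  have id: "id = (\<lambda>x. conv_one H H x - aug x)"
    by (simp add: fun_eq_iff aug_def)
  have add: "additive (aug_sum N)"
    by (rule additive_diffI) (simp add: aug_sum_def additive_simps additive_aug_pow sum_subtractf)
  have "conv H H aug (aug_sum N) x = (\<Sum>k\<le>N. aug_pow (Suc k) x)"
    unfolding aug_sum_def[abs_def] by (simp add: conv_sum_right[OF coalgebra algebra])
  then show "conv H H id (aug_sum N) x = conv_one H H x - aug_pow (Suc N) x"
    using sum_telescope[of "\<lambda>k. aug_pow k x" N]
    by (simp add: id conv_diff_left[OF coalgebra algebra] conv_one_left[OF coalgebra algebra add]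
      aug_sum_def sum_subtractf del: aug_pow.simps(2))
  have "conv H H (aug_sum N) aug x = (\<Sum>k\<le>N. aug_pow (Suc k) x)"
    unfolding aug_sum_def[abs_def]
    by (simp add: conv_sum_left[OF coalgebra algebra] aug_pow_commute del: aug_pow.simps(2))
  then show "conv H H (aug_sum N) id x = conv_one H H x - aug_pow (Suc N) x"
    using sum_telescope[of "\<lambda>k. aug_pow k x" N]
    by (simp add: id conv_diff_right[OF coalgebra algebra] conv_one_right[OF coalgebra algebra add]
      aug_sum_def sum_subtractf del: aug_pow.simps(2))
qed

text \<open>Factors in the coproduct of \<open>b\<close> have at most the degree N of
  \<open>b\<close>, so \<open>S\<close> agrees on them with \<open>aug_sum N\<close>; the remainder,
  the power N + 1 of \<open>aug\<close>, vanishes on \<open>b\<close>.\<close>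

lemma is_antipode_S: "is_antipode H S"
proof -
  have basis: "conv H H S id (frag_of b) = conv_one H H (frag_of b)"
    "conv H H id S (frag_of b) = conv_one H H (frag_of b)" for b
  proof -
    let ?N = "deg H b"
    have "comul H (frag_of b) \<in> hcomp2 H ?N"
      by (simp add: comul_graded)
    then have "S (frag_of a) = aug_sum ?N (frag_of a)" "S (frag_of c) = aug_sum ?N (frag_of c)"
      if "(a, c) \<in> Poly_Mapping.keys (comul H (frag_of b))" for a c
      using that by (auto simp: hcomp2_def intro!: S_frag_of)
    then have "conv H H S id (frag_of b) = conv H H (aug_sum ?N) id (frag_of b)"
      "conv H H id S (frag_of b) = conv H H id (aug_sum ?N) (frag_of b)"
      unfolding conv_def by (auto intro!: arg_cong[where f = "mul H"] tens_map_cong)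
    then show "conv H H S id (frag_of b) = conv_one H H (frag_of b)"
      "conv H H id S (frag_of b) = conv_one H H (frag_of b)"
      using aug_pow_eq_0[of "frag_of b" ?N "Suc ?N"]
      by (simp_all add: conv_id_aug_sum del: aug_pow.simps)
  qed
  have "additive (conv H H f g)" "additive (conv_one H H)" for f g
    by (simp_all add: additive_conv additive_conv_one coalgebra algebra)
  then have "conv H H S id x = conv_one H H x" "conv H H id S x = conv_one H H x" for x
    using additive_ext[of "conv H H S id" "conv_one H H"] additive_ext[of "conv H H id S" "conv_one H H"]
      basis by blast+
  then show ?thesis
    by (simp add: is_antipode_iff_conv fun_eq_iff) (simp add: S_def additive_frag_extend)
qed

text \<open>Uniqueness of inverses turns the definite description \<open>antipode H\<close> into
  \<open>S\<close>, which then passes on its grading.\<close>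

theorem connected_graded_hopf_algebra: "is_connected_graded_hopf_algebra H"
proof -
  have unique: "T = S" if "is_antipode H T" for T
    using that is_antipode_S conv_inverse_unique[OF coalgebra algebra, of T S id]
    by (simp add: is_antipode_iff_conv)
  then have "antipode H = S"
    unfolding antipode_def using is_antipode_S by (intro the_equality)
  moreover have "\<exists>!S. is_antipode H S"
    using is_antipode_S unique by blast
  ultimately show ?thesis
    using bialgebra mul_graded unit_graded comul_graded counit_graded connected S_graded
    by (auto simp: is_connected_graded_hopf_algebra_def is_graded_hopf_algebra_def
      is_hopf_algebra_def)
qed

end


section \<open>Transfer along injective maps of bases\<close>

lemma mul2_simps [simp]:
  "mul2 H 0 v = 0" "mul2 H u 0 = 0"
  "mul2 H (u - u') v = mul2 H u v - mul2 H u' v" "mul2 H u (v - v') = mul2 H u v - mul2 H u v'"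
  "mul2 H (frag_of (a, b)) (frag_of (c, d)) = tens (mul H (frag_of (a, c))) (mul H (frag_of (b, d)))"
  by (simp_all add: mul2_def frag_extend_diff)

lemma additive_mul2: "additive (\<lambda>u. mul2 H u v)" "additive (mul2 H u)"
  by (simp_all add: additive_diffI)

definition frag_map :: "('a \<Rightarrow> 'b) \<Rightarrow> ('a \<Rightarrow>\<^sub>0 int) \<Rightarrow> ('b \<Rightarrow>\<^sub>0 int)" where
  "frag_map j = frag_extend (frag_of \<circ> j)"

lemma frag_map_simps [simp]:
  "frag_map j 0 = 0" "frag_map j (x - y) = frag_map j x - frag_map j y"
  "frag_map j (frag_of a) = frag_of (j a)"
  by (simp_all add: frag_map_def frag_extend_diff)

lemma additive_frag_map: "additive (frag_map j)"
  by (simp add: additive_diffI)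

lemma frag_map_inv:
  assumes "inj j"
  shows "frag_map (inv j) (frag_map j x) = x"
  using frag_expansion[of x] assms by (simp add: frag_map_def frag_extend_compose comp_assoc)

lemma inj_frag_map: "inj j \<Longrightarrow> inj (frag_map j)"
  by (metis injI frag_map_inv)

lemma keys_frag_map_subset: "Poly_Mapping.keys (frag_map j x) \<subseteq> j ` Poly_Mapping.keys x"
  using keys_frag_extend[of "frag_of \<circ> j" x] by (auto simp: frag_map_def)

text \<open>Injectivity keeps coefficients from cancelling. The reverse inclusion is the subset
  lemma for \<open>inv j\<close>, which recovers \<open>x\<close>.\<close>

lemma keys_frag_map:
  assumes "inj j"
  shows "Poly_Mapping.keys (frag_map j x) = j ` Poly_Mapping.keys x"
proof (rule equalityI[OF keys_frag_map_subset])
  have "Poly_Mapping.keys x \<subseteq> inv j ` Poly_Mapping.keys (frag_map j x)"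
    using keys_frag_map_subset[of "inv j" "frag_map j x"] by (simp only: frag_map_inv[OF assms])
  then have "j ` Poly_Mapping.keys x \<subseteq> j ` inv j ` Poly_Mapping.keys (frag_map j x)"
    by (rule image_mono)
  also have "\<dots> = Poly_Mapping.keys (frag_map j x)"
    by (rule image_inv_into_cancel[OF refl]) (use keys_frag_map_subset[of j x] in blast)
  finally show "j ` Poly_Mapping.keys x \<subseteq> Poly_Mapping.keys (frag_map j x)" .
qed

text \<open>Tensor powers of a map induced by bases are again induced by bases, and so inherit
  injectivity from \<open>j\<close>.\<close>

lemma tens_map_frag_map: "tens_map (frag_map i) (frag_map j) = frag_map (map_prod i j)"
proof
  show "tens_map (frag_map i) (frag_map j) u = frag_map (map_prod i j) u" for u
  proof (induction u rule: frag_induct)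
    case (of p)
    then show ?case by (cases p) simp
  qed simp_all
qed

text \<open>Each axiom of \<open>H\<close> is an equation in the integers or in one of the first
  three tensor powers of \<open>H\<close>. Applying the injective map induced by \<open>j\<close>
  and moving it inwards turns an equation of the latter sort into the same axiom of
  \<open>K\<close>; integer equations carry over because counits agree.\<close>

lemma connected_graded_bialgebra_pullback:
  fixes H :: "'a bialg" and K :: "'b bialg" and j :: "'a \<Rightarrow> 'b"
  assumes K: "connected_graded_bialgebra K" and j: "inj j"
    and additive: "additive (mul H)" "additive (comul H)" "additive (counit H)"
    and mul: "\<And>x y. frag_map j (mul H (tens x y)) = mul K (tens (frag_map j x) (frag_map j y))"
    and unit: "frag_map j (unit H) = unit K"
    and comul: "\<And>x. comul K (frag_map j x) = tens_map (frag_map j) (frag_map j) (comul H x)"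
    and counit: "\<And>x. counit K (frag_map j x) = counit H x"
    and deg: "\<And>a. deg K (j a) = deg H a"
  shows "connected_graded_bialgebra H"
proof -
  interpret K: connected_graded_bialgebra K by fact
  let ?f = "frag_map j"
  let ?f2 = "tens_map ?f ?f"
  note additive_K = mul_additive[OF K.coalgebra K.algebra] comul_additive[OF K.coalgebra K.algebra]
  \<comment> \<open>\<open>f\<close>, \<open>f2\<close> and \<open>f3\<close> replace an equation by
    its image in one, two and three tensor factors; reversed, they serve to apply the map to a
    goal.\<close>
  note f = inj_eq[OF inj_frag_map[OF j]]
  have j2: "inj (map_prod j j)" and j3: "inj (map_prod j (map_prod j j))"
    using j by (simp_all add: prod.inj_map)
  note f2 = inj_eq[OF inj_frag_map[OF j2], folded tens_map_frag_map]
  note f3 = inj_eq[OF inj_frag_map[OF j3], folded tens_map_frag_map]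
  \<comment> \<open>The assumption \<open>mul\<close> concerns pure tensors; additivity extends it
    to all of H \<otimes> H.\<close>
  have mul': "?f (mul H u) = mul K (?f2 u)" for u
  proof (induction u rule: frag_induct)
    case (of p)
    then show ?case
      using mul[of "frag_of (fst p)" "frag_of (snd p)"] by (cases p) simp
  qed (simp_all add: additive additive_K additive_simps)
  have assoc: "tens_map ?f ?f2 (tens_assoc w) = tens_assoc (tens_map ?f2 ?f w)" for w
  proof (induction w rule: frag_induct)
    case (of p)
    then show ?case
      by (cases p) (auto simp: tens_assoc_tens)
  qed simp_all
  have mul2: "?f2 (mul2 H u v) = mul2 K (?f2 u) (?f2 v)" for u v
  proof (induction u rule: frag_induct)
    case (of p)
    show ?case
    proof (induction v rule: frag_induct)
      case (of q)
      show ?case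
        by (cases p; cases q) (simp add: tens_map_tens additive_frag_map mul')
    qed simp_all
  qed simp_all
  have algebra: "is_algebra H"
    unfolding is_algebra_def
  proof (intro conjI allI)
    show "mul H (tens (mul H (tens x y)) z) = mul H (tens x (mul H (tens y z)))" for x y z
      using K.algebra by (simp add: f[symmetric] mul is_algebra_def)
    show "mul H (tens (unit H) x) = x" "mul H (tens x (unit H)) = x" for x
      using K.algebra by (simp_all add: f[symmetric] mul unit is_algebra_def)
  qed fact
  have counit_left: "?f (frag_extend (\<lambda>(a, b). frag_cmul (counit H (frag_of a)) (frag_of b)) u) =
      frag_extend (\<lambda>(a, b). frag_cmul (counit K (frag_of a)) (frag_of b)) (?f2 u)" for u
  proof (induction u rule: frag_induct)
    case (of p)
    then show ?case
      using counit[of "frag_of (fst p)"] by (cases p) (simp add: additive_cmul[OF additive_frag_map])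
  qed (simp_all add: frag_extend_diff)
  have counit_right: "?f (frag_extend (\<lambda>(a, b). frag_cmul (counit H (frag_of b)) (frag_of a)) u) =
      frag_extend (\<lambda>(a, b). frag_cmul (counit K (frag_of b)) (frag_of a)) (?f2 u)" for u
  proof (induction u rule: frag_induct)
    case (of p)
    then show ?case
      using counit[of "frag_of (snd p)"] by (cases p) (simp add: additive_cmul[OF additive_frag_map])
  qed (simp_all add: frag_extend_diff)
  have coalgebra: "is_coalgebra H"
    unfolding is_coalgebra_def
  proof (intro conjI allI)
    fix x
    have add: "additive id" "additive ?f" "additive ?f2"
      by (simp_all add: additive_diffI)
    have comul_f: "comul K \<circ> ?f = ?f2 \<circ> comul H"
      by (simp add: fun_eq_iff comul)
    have "tens_map ?f2 ?f (tens_map (comul H) id u) = tens_map (comul K) id (?f2 u)"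
      "tens_map ?f ?f2 (tens_map id (comul H) u) = tens_map id (comul K) (?f2 u)" for u
      by (simp_all add: tens_map_comp add additive_K comul_f)
    moreover have "tens_assoc (tens_map (comul K) id (?f2 (comul H x))) =
        tens_map id (comul K) (?f2 (comul H x))"
      using K.coalgebra unfolding is_coalgebra_def comul[symmetric] by blast
    ultimately have "tens_map ?f ?f2 (tens_assoc (tens_map (comul H) id (comul H x))) =
        tens_map ?f ?f2 (tens_map id (comul H) (comul H x))"
      by (simp add: assoc)
    then show "tens_assoc (tens_map (comul H) id (comul H x)) = tens_map id (comul H) (comul H x)"
      by (simp only: f3)
    show "frag_extend (\<lambda>(a, b). frag_cmul (counit H (frag_of a)) (frag_of b)) (comul H x) = x"
      "frag_extend (\<lambda>(a, b). frag_cmul (counit H (frag_of b)) (frag_of a)) (comul H x) = x"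
      using K.coalgebra
      by (simp_all add: f[symmetric] counit_left counit_right comul[symmetric] is_coalgebra_def)
  qed fact+
  \<comment> \<open>The support of the image is the image of the support and \<open>j\<close>
    preserves degrees, so homogeneity may be tested after \<open>?f\<close>.\<close>
  have hcomp: "x \<in> hcomp H n \<longleftrightarrow> ?f x \<in> hcomp K n" for x n
    by (simp add: hcomp_def keys_frag_map j deg)
  have hcomp2: "u \<in> hcomp2 H n \<longleftrightarrow> ?f2 u \<in> hcomp2 K n" for u n
    by (simp add: hcomp2_def tens_map_frag_map keys_frag_map j2 deg case_prod_unfold)
  have bialgebra: "is_bialgebra H"
    unfolding is_bialgebra_def
  proof (intro conjI allI algebra coalgebra)
    show "comul H (mul H (tens x y)) = mul2 H (comul H x) (comul H y)" for x y
      using K.bialgebra by (simp add: f2[symmetric] mul2 comul[symmetric] mul is_bialgebra_def)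
    show "comul H (unit H) = tens (unit H) (unit H)"
      using K.bialgebra by (simp add: f2[symmetric] comul[symmetric] unit tens_map_tens
        additive_frag_map is_bialgebra_def)
    show "counit H (mul H (tens x y)) = counit H x * counit H y" for x y
      using K.bialgebra by (simp add: counit[symmetric] mul is_bialgebra_def)
    show "counit H (unit H) = 1"
      using K.bialgebra by (simp add: counit[symmetric] unit is_bialgebra_def)
  qed
  show ?thesis
  proof
    show "is_bialgebra H" by fact
    show "mul H u \<in> hcomp H n" if "u \<in> hcomp2 H n" for u n
      using that K.mul_graded by (simp add: hcomp hcomp2 mul')
    show "unit H \<in> hcomp H 0"
      using K.unit_graded by (simp add: hcomp unit)
    show "comul H x \<in> hcomp2 H n" if "x \<in> hcomp H n" for x n
      using that K.comul_graded by (simp add: hcomp hcomp2 comul[symmetric])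
    show "counit H x = 0" if "x \<in> hcomp H n" "n > 0" for x n
      using that K.counit_graded by (simp add: hcomp counit[symmetric])
    have cmul: "?f (frag_cmul k (unit H)) = frag_cmul k (unit K)" for k
      by (simp add: additive_cmul[OF additive_frag_map] unit)
    have inj: "inj (\<lambda>k. frag_cmul k (unit K))" and range: "range (\<lambda>k. frag_cmul k (unit K)) = hcomp K 0"
      using K.connected by (auto simp: bij_betw_def)
    have "x \<in> range (\<lambda>k. frag_cmul k (unit H)) \<longleftrightarrow> x \<in> hcomp H 0" for x
      unfolding hcomp range[symmetric] image_iff f[symmetric] cmul ..
    moreover have "inj (\<lambda>k. frag_cmul k (unit H))"
      using inj unfolding inj_def f[symmetric] cmul .
    ultimately show "bij_betw (\<lambda>k. frag_cmul k (unit H)) UNIV (hcomp H 0)"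
      by (auto simp: bij_betw_def)
  qed
qed


section \<open>Sums over shuffles and cuts\<close>

text \<open>Abstracting the summand, here and in \<open>cut_sum\<close>, makes the recursion on
  words prefix a letter inside \<open>F\<close>; inductions then generalise over \<open>F\<close>
  without handling lists of shuffles or sets of cuts.\<close>

definition shuffle_sum :: "('a list \<Rightarrow> 'b :: comm_monoid_add) \<Rightarrow> 'a list \<Rightarrow> 'a list \<Rightarrow> 'b" where
  "shuffle_sum F a b = (\<Sum>c\<leftarrow>shuffle a b. F c)"

definition cut_sum :: "('a list \<Rightarrow> 'a list \<Rightarrow> 'b :: comm_monoid_add) \<Rightarrow> 'a list \<Rightarrow> 'b" where
  "cut_sum F w = (\<Sum>(u, v)\<in>cuts w. F u v)"

lemma shuffle_Nil2 [simp]: "shuffle a [] = [a]"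
  by (cases a) simp_all

lemma shuffle_sum_simps [simp]:
  "shuffle_sum F [] = F" "shuffle_sum F a [] = F a"
  "shuffle_sum F (x # a) (y # b) =
    shuffle_sum (\<lambda>c. F (x # c)) a (y # b) + shuffle_sum (\<lambda>c. F (y # c)) (x # a) b"
  by (simp_all add: shuffle_sum_def fun_eq_iff comp_def)

lemma shuffle_sum_add: "shuffle_sum (\<lambda>c. F c + G c) a b = shuffle_sum F a b + shuffle_sum G a b"
  by (simp add: shuffle_sum_def sum_list_addf)

lemma shuffle_sum_cong:
  "(\<And>c. c \<in> shuffles a b \<Longrightarrow> F c = G c) \<Longrightarrow> shuffle_sum F a b = shuffle_sum G a b"
  unfolding shuffle_sum_def set_shuffle[symmetric]
  by (intro arg_cong[where f = sum_list] map_cong) auto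

lemma additive_shuffle_sum: "additive f \<Longrightarrow> f (shuffle_sum F a b) = shuffle_sum (\<lambda>c. f (F c)) a b"
  by (simp add: shuffle_sum_def additive_simps)

lemma shuffle_sum_assoc:
  "shuffle_sum (\<lambda>d. shuffle_sum F d c) a b = shuffle_sum (shuffle_sum F a) b c"
proof (induction "length a + length b + length c" arbitrary: a b c F rule: less_induct)
  case less
  show ?case
  proof (cases "a = [] \<or> b = [] \<or> c = []")
    case False
    then obtain x a' y b' z c' where [simp]: "a = x # a'" "b = y # b'" "c = z # c'"
      by (meson neq_Nil_conv)
    \<comment> \<open>One instance for each of the three words that may supply the first letter of
      the triple shuffle.\<close>
    have IH: "shuffle_sum (\<lambda>d. shuffle_sum (\<lambda>e. F (x # e)) d c) a' b =
          shuffle_sum (shuffle_sum (\<lambda>e. F (x # e)) a') b c"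
      "shuffle_sum (\<lambda>d. shuffle_sum (\<lambda>e. F (y # e)) d c) a b' =
          shuffle_sum (shuffle_sum (\<lambda>e. F (y # e)) a) b' c"
      "shuffle_sum (\<lambda>d. shuffle_sum (\<lambda>e. F (z # e)) d c') a b =
          shuffle_sum (shuffle_sum (\<lambda>e. F (z # e)) a) b c'"
      by (rule less; simp)+
    then show ?thesis
      by (simp add: shuffle_sum_add algebra_simps)
  qed auto
qed

lemma cut_sum_Nil [simp]: "cut_sum F [] = F [] []"
  by (simp add: cut_sum_def cuts_def)

lemma cut_sum_Cons [simp]: "cut_sum F (x # w) = F [] (x # w) + cut_sum (\<lambda>u v. F (x # u) v) w"
proof -
  have "cuts (x # w) = insert ([], x # w) (map_prod ((#) x) id ` cuts w)"
    by (auto simp: cuts_def Cons_eq_append_conv append_eq_Cons_conv image_iff)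
  moreover have "inj_on (map_prod ((#) x) id) (cuts w)"
    by (auto simp: inj_on_def)
  moreover have "([], x # w) \<notin> map_prod ((#) x) id ` cuts w"
    by auto
  ultimately show ?thesis
    by (simp add: cut_sum_def finite_cuts sum.reindex case_prod_unfold)
qed

lemma cut_sum_add: "cut_sum (\<lambda>u v. F u v + G u v) w = cut_sum F w + cut_sum G w"
  by (simp add: cut_sum_def case_prod_unfold sum.distrib)

lemma cut_sum_cong:
  "(\<And>u v. w = u @ v \<Longrightarrow> F u v = G u v) \<Longrightarrow> cut_sum F w = cut_sum G w"
  unfolding cut_sum_def by (intro sum.cong) (auto simp: cuts_def)

lemma additive_cut_sum: "additive f \<Longrightarrow> f (cut_sum F w) = cut_sum (\<lambda>u v. f (F u v)) w"
  by (simp add: cut_sum_def additive_simps case_prod_unfold)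

lemma sum_good_cuts:
  "(\<Sum>(u, v)\<in>good_cuts w. F u v) = cut_sum (\<lambda>u v. if set u \<inter> set v = {} then F u v else 0) w"
proof -
  have "good_cuts w = {c \<in> cuts w. set (fst c) \<inter> set (snd c) = {}}"
    by (auto simp: good_cuts_def)
  then show ?thesis
    by (simp add: cut_sum_def case_prod_unfold sum.inter_filter finite_cuts)
qed

lemma cut_sum_assoc:
  "cut_sum (\<lambda>u v. cut_sum (\<lambda>u1 u2. F u1 u2 v) u) w =
   cut_sum (\<lambda>u1 v. cut_sum (\<lambda>u2 u3. F u1 u2 u3) v) w"
  by (induction w arbitrary: F) (simp_all add: cut_sum_add algebra_simps)

lemma cut_sum_only_left:
  fixes F :: "'a list \<Rightarrow> 'a list \<Rightarrow> 'b :: comm_monoid_add"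
  assumes "\<And>u v. u \<noteq> [] \<Longrightarrow> F u v = 0"
  shows "cut_sum F w = F [] w"
proof -
  have "cut_sum (\<lambda>_ _. 0 :: 'b) w = 0" for w :: "'a list"
    by (induction w) simp_all
  then show ?thesis
    by (cases w) (simp_all add: assms)
qed

lemma cut_sum_only_right:
  assumes "\<And>u v. v \<noteq> [] \<Longrightarrow> F u v = 0"
  shows "cut_sum F w = F w []"
  using assms by (induction w arbitrary: F) simp_all

text \<open>In the main case both sides split three ways: the left part of the cut is empty, begins
  with \<open>x\<close>, or begins with \<open>y\<close>. The last two are induction hypotheses with
  that letter prefixed inside \<open>F\<close>.\<close>

lemma cut_sum_shuffle_sum:
  "shuffle_sum (cut_sum F) a b =
   cut_sum (\<lambda>a1 a2. cut_sum (\<lambda>b1 b2. shuffle_sum (\<lambda>u. shuffle_sum (F u) a2 b2) a1 b1) b) a"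
proof (induction a b arbitrary: F rule: shuffle.induct)
  case (3 x a y b)
  have "shuffle_sum (cut_sum F) (x # a) (y # b) = shuffle_sum (F []) (x # a) (y # b) +
      (shuffle_sum (cut_sum (\<lambda>u. F (x # u))) a (y # b) +
       shuffle_sum (cut_sum (\<lambda>u. F (y # u))) (x # a) b)"
    by (simp add: shuffle_sum_add algebra_simps)
  then show ?case
    unfolding 3 by (simp add: shuffle_sum_add cut_sum_add algebra_simps)
qed simp_all


section \<open>The bialgebra of double words\<close>

text \<open>Shifting all letters beyond a bound of \<open>X\<close> frees the representative from
  \<open>X\<close>, so that factors of a product can be given disjoint supports.\<close>

lemma subst_cases:
  assumes "finite X"
  obtains \<rho> \<sigma> where "p = abs_subst (\<rho>, \<sigma>)" "set \<rho> = set \<sigma>" "set \<rho> \<inter> X = {}"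
proof -
  obtain \<rho> \<sigma> where r: "rep_subst p = (\<rho>, \<sigma>)"
    by fastforce
  have p: "p = abs_subst (\<rho>, \<sigma>)"
    using Quotient3_abs_rep[OF Quotient3_subst, of p] r by simp
  have eq: "set \<rho> = set \<sigma>"
    using Quotient3_rep_reflp[OF Quotient3_subst, of p] r by (simp add: renaming_def)
  obtain N where N: "\<forall>x\<in>X. x < N"
    using assms finite_nat_set_iff_bounded by blast
  have "abs_subst (map ((+) N) \<rho>, map ((+) N) \<sigma>) = p"
    unfolding p by (rule abs_subst_map[OF eq]) simp
  moreover have "set (map ((+) N) \<rho>) \<inter> X = {}"
    using N by auto
  ultimately show ?thesis
    using that[of "map ((+) N) \<rho>" "map ((+) N) \<sigma>"] eq by simp
qed

text \<open>One tensor factor of a coproduct. Keeping the full upper word \<rho> lets iterated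
  coproducts refer to the same \<rho>.\<close>

definition restr :: "nat list \<Rightarrow> nat list \<Rightarrow> subst" where
  "restr \<rho> u = abs_subst (preim \<rho> u, u)"

lemma set_preim: "set u \<subseteq> set \<rho> \<Longrightarrow> set (preim \<rho> u) = set u"
  by (auto simp: preim_def)

lemma restr_self: "set \<rho> = set \<sigma> \<Longrightarrow> restr \<rho> \<sigma> = abs_subst (\<rho>, \<sigma>)"
  by (simp add: restr_def preim_def)

lemma preim_preim: "set u \<subseteq> set v \<Longrightarrow> preim (preim \<rho> v) u = preim \<rho> u"
  by (auto simp: preim_def intro!: filter_cong)

lemma dwha_deg_restr: "set u \<subseteq> set \<rho> \<Longrightarrow> dwha_deg (restr \<rho> u) = card (set u)"
  by (simp add: restr_def dwha_deg_abs set_preim)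

text \<open>The degree detects emptiness without unfolding the quotient.\<close>

lemma restr_eq_empty_iff:
  assumes "set u \<subseteq> set \<rho>"
  shows "restr \<rho> u = abs_subst ([], []) \<longleftrightarrow> u = []"
proof
  assume "restr \<rho> u = abs_subst ([], [])"
  then have "card (set u) = 0"
    using dwha_deg_restr[OF assms] dwha_deg_abs[of "[]" "[]"] by simp
  then show "u = []"
    by simp
qed (simp add: restr_def preim_def)

section \<open>Product and coproduct on representatives\<close>

lemma dwha_mul_shuffle_sum:
  assumes "set \<rho> = set \<sigma>" "set \<rho>' = set \<sigma>'" "set \<rho> \<inter> set \<rho>' = {}"
  shows "dwha_mul (abs_subst (\<rho>, \<sigma>)) (abs_subst (\<rho>', \<sigma>')) =
    shuffle_sum (\<lambda>\<gamma>. frag_of (abs_subst (\<rho> @ \<rho>', \<gamma>))) \<sigma> \<sigma>'"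
  using dwha_mul_abs[OF assms] by (simp add: shuffle_sum_def)

lemma dwha_comul_cut_sum:
  assumes "set \<rho> = set \<sigma>"
  shows "dwha_comul (abs_subst (\<rho>, \<sigma>)) =
    cut_sum (\<lambda>u v. if set u \<inter> set v = {} then frag_of (restr \<rho> u, restr \<rho> v) else 0) \<sigma>"
  unfolding dwha_comul_abs[OF assms] sum_good_cuts restr_def ..

lemma dwha_comul_restr:
  assumes "set w \<subseteq> set \<rho>"
  shows "dwha_comul (restr \<rho> w) =
    cut_sum (\<lambda>u v. if set u \<inter> set v = {} then frag_of (restr \<rho> u, restr \<rho> v) else 0) w"
proof -
  have "dwha_comul (restr \<rho> w) = cut_sum (\<lambda>u v. if set u \<inter> set v = {} then
      frag_of (restr (preim \<rho> w) u, restr (preim \<rho> w) v) else 0) w"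
    unfolding restr_def[of \<rho> w] by (rule dwha_comul_cut_sum) (simp add: set_preim assms)
  also have "\<dots> = cut_sum (\<lambda>u v. if set u \<inter> set v = {} then frag_of (restr \<rho> u, restr \<rho> v) else 0) w"
    by (rule cut_sum_cong) (simp add: restr_def preim_preim)
  finally show ?thesis .
qed

lemma dWHA_simps [simp]:
  "mul dWHA 0 = 0" "mul dWHA (u - v) = mul dWHA u - mul dWHA v"
  "mul dWHA (frag_of (p, q)) = dwha_mul p q"
  "unit dWHA = frag_of (abs_subst ([], []))"
  "comul dWHA 0 = 0" "comul dWHA (x - y) = comul dWHA x - comul dWHA y"
  "comul dWHA (frag_of p) = dwha_comul p"
  "counit dWHA x = Poly_Mapping.lookup x (abs_subst ([], []))"
  "deg dWHA = dwha_deg"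
  by (simp_all add: dWHA_def frag_extend_diff)

lemma additive_dWHA: "additive (mul dWHA)" "additive (comul dWHA)" "additive (counit dWHA)"
  by (simp_all add: additive_diffI lookup_minus)

text \<open>With pairwise disjoint representatives both bracketings have the concatenation of the
  three upper words on top and the triple shuffles of the lower words below.\<close>

lemma dwha_mul_assoc:
  "mul dWHA (tens (dwha_mul p q) (frag_of r)) = mul dWHA (tens (frag_of p) (dwha_mul q r))"
proof -
  obtain \<rho> \<sigma> where p: "p = abs_subst (\<rho>, \<sigma>)" "set \<rho> = set \<sigma>"
    using subst_cases[of "{}" p] by auto
  obtain \<rho>' \<sigma>' where q: "q = abs_subst (\<rho>', \<sigma>')" "set \<rho>' = set \<sigma>'" "set \<rho>' \<inter> set \<rho> = {}"
    using subst_cases[of "set \<rho>" q] by auto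
  obtain \<rho>'' \<sigma>'' where r: "r = abs_subst (\<rho>'', \<sigma>'')" "set \<rho>'' = set \<sigma>''"
      "set \<rho>'' \<inter> (set \<rho> \<union> set \<rho>') = {}"
    using subst_cases[of "set \<rho> \<union> set \<rho>'" r] by auto
  note additive = additive_shuffle_sum[OF additive_tens(1)] additive_shuffle_sum[OF additive_tens(2)]
    additive_shuffle_sum[OF additive_dWHA(1)]
  have "mul dWHA (tens (dwha_mul p q) (frag_of r)) =
      shuffle_sum (\<lambda>\<gamma>. dwha_mul (abs_subst (\<rho> @ \<rho>', \<gamma>)) r) \<sigma> \<sigma>'"
    using p q by (subst p(1), subst q(1), subst dwha_mul_shuffle_sum) (auto simp: additive)
  also have "\<dots> = shuffle_sum (\<lambda>\<gamma>. shuffle_sum (\<lambda>\<delta>. frag_of (abs_subst (\<rho> @ \<rho>' @ \<rho>'', \<delta>))) \<gamma> \<sigma>'') \<sigma> \<sigma>'"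
  proof (rule shuffle_sum_cong)
    fix \<gamma> assume "\<gamma> \<in> shuffles \<sigma> \<sigma>'"
    then have "set (\<rho> @ \<rho>') = set \<gamma>"
      using p q set_shuffles by fastforce
    moreover have "set (\<rho> @ \<rho>') \<inter> set \<rho>'' = {}"
      using r by auto
    ultimately show "dwha_mul (abs_subst (\<rho> @ \<rho>', \<gamma>)) r =
        shuffle_sum (\<lambda>\<delta>. frag_of (abs_subst (\<rho> @ \<rho>' @ \<rho>'', \<delta>))) \<gamma> \<sigma>''"
      using dwha_mul_shuffle_sum[of "\<rho> @ \<rho>'" \<gamma> \<rho>'' \<sigma>''] r by simp
  qed
  also have "\<dots> = shuffle_sum (shuffle_sum (\<lambda>\<delta>. frag_of (abs_subst (\<rho> @ \<rho>' @ \<rho>'', \<delta>))) \<sigma>) \<sigma>' \<sigma>''"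
    by (rule shuffle_sum_assoc)
  also have "\<dots> = shuffle_sum (\<lambda>\<gamma>. dwha_mul p (abs_subst (\<rho>' @ \<rho>'', \<gamma>))) \<sigma>' \<sigma>''"
  proof (rule shuffle_sum_cong)
    fix \<gamma> assume "\<gamma> \<in> shuffles \<sigma>' \<sigma>''"
    then have "set (\<rho>' @ \<rho>'') = set \<gamma>"
      using q r set_shuffles by fastforce
    moreover have "set \<rho> \<inter> set (\<rho>' @ \<rho>'') = {}"
      using q r by auto
    ultimately show "shuffle_sum (\<lambda>\<delta>. frag_of (abs_subst (\<rho> @ \<rho>' @ \<rho>'', \<delta>))) \<sigma> \<gamma> =
        dwha_mul p (abs_subst (\<rho>' @ \<rho>'', \<gamma>))"
      using dwha_mul_shuffle_sum[of \<rho> \<sigma> "\<rho>' @ \<rho>''" \<gamma>] p by simp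
  qed
  also have "\<dots> = mul dWHA (tens (frag_of p) (dwha_mul q r))"
    using q r by (subst q(1), subst r(1), subst dwha_mul_shuffle_sum) (auto simp: additive)
  finally show ?thesis .
qed

lemma dWHA_algebra: "is_algebra dWHA"
  unfolding is_algebra_def
proof (intro conjI allI)
  show "mul dWHA (tens (mul dWHA (tens x y)) z) = mul dWHA (tens x (mul dWHA (tens y z)))" for x y z
  proof (induction x rule: frag_induct)
    case (of p)
    show ?case
    proof (induction y rule: frag_induct)
      case (of q)
      show ?case
        by (induction z rule: frag_induct) (simp_all add: dwha_mul_assoc)
    qed simp_all
  qed simp_all
  have "dwha_mul (abs_subst ([], [])) p = frag_of p" "dwha_mul p (abs_subst ([], [])) = frag_of p" for p
  proof -
    obtain \<rho> \<sigma> where p: "p = abs_subst (\<rho>, \<sigma>)" "set \<rho> = set \<sigma>"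
      using subst_cases[of "{}" p] by auto
    then show "dwha_mul (abs_subst ([], [])) p = frag_of p" "dwha_mul p (abs_subst ([], [])) = frag_of p"
      by (simp_all add: dwha_mul_shuffle_sum)
  qed
  then show "mul dWHA (tens (unit dWHA) x) = x" "mul dWHA (tens x (unit dWHA)) = x" for x
    by (induction x rule: frag_induct) simp_all
qed (rule additive_dWHA)

text \<open>Both sides sum over cuts into three pieces with pairwise disjoint supports, the
  condition in \<open>?F\<close>: it says exactly that the outer and the inner cut are good,
  whichever is made first.\<close>

lemma dwha_comul_coassoc:
  "tens_assoc (tens_map (comul dWHA) id (dwha_comul p)) = tens_map id (comul dWHA) (dwha_comul p)"
proof -
  obtain \<rho> \<sigma> where p: "p = abs_subst (\<rho>, \<sigma>)" "set \<rho> = set \<sigma>"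
    using subst_cases[of "{}" p] by auto
  let ?F = "\<lambda>u v w. if set u \<inter> set v = {} \<and> set u \<inter> set w = {} \<and> set v \<inter> set w = {}
    then frag_of (restr \<rho> u, restr \<rho> v, restr \<rho> w) else 0"
  have zero: "cut_sum (\<lambda>_ _. 0) w = (0 :: subst \<times> subst \<times> subst \<Rightarrow>\<^sub>0 int)" for w :: "nat list"
    by (rule cut_sum_only_left) simp
  note additive = additive_cut_sum[OF additive_tens(1)] additive_cut_sum[OF additive_tens(2)]
    additive_cut_sum[OF additive_tens_map] additive_cut_sum[OF additive_tens_assoc]
  have "tens_assoc (tens_map (comul dWHA) id (dwha_comul p)) =
      cut_sum (\<lambda>u v. if set u \<inter> set v = {} then
        tens_assoc (tens (dwha_comul (restr \<rho> u)) (frag_of (restr \<rho> v))) else 0) \<sigma>"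
    by (simp add: p dwha_comul_cut_sum additive if_distrib[of "tens_map _ _"] if_distrib[of tens_assoc]
      cong: if_cong)
  also have "\<dots> = cut_sum (\<lambda>u w. cut_sum (\<lambda>u1 u2. ?F u1 u2 w) u) \<sigma>"
  proof (rule cut_sum_cong)
    fix u v assume "\<sigma> = u @ v"
    then have u: "set u \<subseteq> set \<rho>"
      using p by simp
    show "(if set u \<inter> set v = {} then
        tens_assoc (tens (dwha_comul (restr \<rho> u)) (frag_of (restr \<rho> v))) else 0) =
        cut_sum (\<lambda>u1 u2. ?F u1 u2 v) u"
    proof (cases "set u \<inter> set v = {}")
      case True
      have "tens_assoc (tens (dwha_comul (restr \<rho> u)) (frag_of (restr \<rho> v))) =
          cut_sum (\<lambda>u1 u2. if set u1 \<inter> set u2 = {} then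
            frag_of (restr \<rho> u1, restr \<rho> u2, restr \<rho> v) else 0) u"
        by (simp add: dwha_comul_restr[OF u] additive if_distrib[of "\<lambda>x. tens x _"]
          if_distrib[of tens_assoc] cong: if_cong)
      also have "\<dots> = cut_sum (\<lambda>u1 u2. ?F u1 u2 v) u"
        using True by (intro cut_sum_cong if_cong) auto
      finally show ?thesis
        using True by simp
    next
      case False
      \<comment> \<open>If the outer cut is bad, \<open>v\<close> shares a letter with
        \<open>u1\<close> or \<open>u2\<close>, so every term vanishes.\<close>
      have "cut_sum (\<lambda>u1 u2. ?F u1 u2 v) u = cut_sum (\<lambda>_ _. 0) u"
        using False by (intro cut_sum_cong) auto
      then show ?thesis
        using False by (simp add: zero)
    qed
  qed
  also have "\<dots> = cut_sum (\<lambda>u v. cut_sum (?F u) v) \<sigma>"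
    by (rule cut_sum_assoc)
  also have "\<dots> = cut_sum (\<lambda>u v. if set u \<inter> set v = {} then
        tens (frag_of (restr \<rho> u)) (dwha_comul (restr \<rho> v)) else 0) \<sigma>"
  proof (rule cut_sum_cong)
    fix u v assume "\<sigma> = u @ v"
    then have v: "set v \<subseteq> set \<rho>"
      using p by simp
    show "cut_sum (?F u) v = (if set u \<inter> set v = {} then
        tens (frag_of (restr \<rho> u)) (dwha_comul (restr \<rho> v)) else 0)"
    proof (cases "set u \<inter> set v = {}")
      case True
      have "tens (frag_of (restr \<rho> u)) (dwha_comul (restr \<rho> v)) =
          cut_sum (\<lambda>v1 v2. if set v1 \<inter> set v2 = {} then
            frag_of (restr \<rho> u, restr \<rho> v1, restr \<rho> v2) else 0) v"
        by (simp add: dwha_comul_restr[OF v] additive if_distrib[of "tens _"] cong: if_cong)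
      also have "\<dots> = cut_sum (?F u) v"
        using True by (intro cut_sum_cong if_cong) auto
      finally show ?thesis
        using True by simp
    next
      case False
      have "cut_sum (?F u) v = cut_sum (\<lambda>_ _. 0) v"
        using False by (intro cut_sum_cong) auto
      then show ?thesis
        using False by (simp add: zero)
    qed
  qed
  also have "\<dots> = tens_map id (comul dWHA) (dwha_comul p)"
    by (simp add: p dwha_comul_cut_sum additive if_distrib[of "tens_map _ _"] cong: if_cong)
  finally show ?thesis .
qed

lemma dWHA_coalgebra: "is_coalgebra dWHA"
  unfolding is_coalgebra_def
proof (intro conjI allI)
  show "tens_assoc (tens_map (comul dWHA) id (comul dWHA x)) = tens_map id (comul dWHA) (comul dWHA x)" for x
    by (induction x rule: frag_induct) (simp_all add: dwha_comul_coassoc del: id_apply)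
  let ?l = "frag_extend (\<lambda>(a, b). frag_cmul (counit dWHA (frag_of a)) (frag_of b))"
  let ?r = "frag_extend (\<lambda>(a, b). frag_cmul (counit dWHA (frag_of b)) (frag_of a))"
  have "?l (dwha_comul p) = frag_of p" "?r (dwha_comul p) = frag_of p" for p
  proof -
    obtain \<rho> \<sigma> where p: "p = abs_subst (\<rho>, \<sigma>)" "set \<rho> = set \<sigma>"
      using subst_cases[of "{}" p] by auto
    \<comment> \<open>The counit leaves only the cut with \<open>u\<close> empty, and that cut is
      always good, so the disjointness test disappears.\<close>
    have "?l (dwha_comul p) = cut_sum (\<lambda>u v. if u = [] then frag_of (restr \<rho> v) else 0) \<sigma>"
      unfolding p(1) dwha_comul_cut_sum[OF p(2)] additive_cut_sum[OF additive_frag_extend]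
      by (rule cut_sum_cong) (use p(2) in \<open>simp add: restr_eq_empty_iff restr_eq_empty_iff[THEN eq_iff_swap]\<close>)
    also have "\<dots> = frag_of p"
      by (subst cut_sum_only_left) (simp_all add: p restr_self)
    finally show "?l (dwha_comul p) = frag_of p" .
    have "?r (dwha_comul p) = cut_sum (\<lambda>u v. if v = [] then frag_of (restr \<rho> u) else 0) \<sigma>"
      unfolding p(1) dwha_comul_cut_sum[OF p(2)] additive_cut_sum[OF additive_frag_extend]
      by (rule cut_sum_cong) (use p(2) in \<open>simp add: restr_eq_empty_iff restr_eq_empty_iff[THEN eq_iff_swap]\<close>)
    also have "\<dots> = frag_of p"
      by (subst cut_sum_only_right) (simp_all add: p restr_self)
    finally show "?r (dwha_comul p) = frag_of p" .
  qed
  then show "?l (comul dWHA x) = x" "?r (comul dWHA x) = x" for x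
    by (induction x rule: frag_induct) (simp_all add: frag_extend_diff del: dWHA_simps(8))
qed (rule additive_dWHA)+

lemma dwha_comul_mul: "comul dWHA (dwha_mul p q) = mul2 dWHA (dwha_comul p) (dwha_comul q)"
proof -
  obtain \<rho> \<sigma> where p: "p = abs_subst (\<rho>, \<sigma>)" "set \<rho> = set \<sigma>"
    using subst_cases[of "{}" p] by auto
  obtain \<rho>' \<sigma>' where q: "q = abs_subst (\<rho>', \<sigma>')" "set \<rho>' = set \<sigma>'" "set \<rho> \<inter> set \<rho>' = {}"
    using subst_cases[of "set \<rho>" q] by (metis List.finite_set inf_commute)
  let ?G = "\<lambda>\<rho> u v. if set u \<inter> set v = {} then frag_of (restr \<rho> u, restr \<rho> v) else 0"
  have "comul dWHA (dwha_mul p q) =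
      shuffle_sum (\<lambda>\<gamma>. dwha_comul (abs_subst (\<rho> @ \<rho>', \<gamma>))) \<sigma> \<sigma>'"
    unfolding p(1) q(1) dwha_mul_shuffle_sum[OF p(2) q(2,3)]
      additive_shuffle_sum[OF additive_dWHA(2)] by simp
  also have "\<dots> = shuffle_sum (cut_sum (?G (\<rho> @ \<rho>'))) \<sigma> \<sigma>'"
    using p q by (intro shuffle_sum_cong dwha_comul_cut_sum) (use set_shuffles in fastforce)
  also have "\<dots> = cut_sum (\<lambda>a1 a2. cut_sum (\<lambda>b1 b2.
      shuffle_sum (\<lambda>u. shuffle_sum (?G (\<rho> @ \<rho>') u) a2 b2) a1 b1) \<sigma>') \<sigma>"
    by (rule cut_sum_shuffle_sum)
  also have "\<dots> = cut_sum (\<lambda>a1 a2. cut_sum (\<lambda>b1 b2. mul2 dWHA (?G \<rho> a1 a2) (?G \<rho>' b1 b2)) \<sigma>') \<sigma>"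
  proof (intro cut_sum_cong)
    fix a1 a2 b1 b2 assume *: "\<sigma> = a1 @ a2" "\<sigma>' = b1 @ b2"
    have sub: "set a1 \<subseteq> set \<rho>" "set a2 \<subseteq> set \<rho>" "set b1 \<subseteq> set \<rho>'" "set b2 \<subseteq> set \<rho>'"
      using p q * by auto
    \<comment> \<open>\<rho> contains no letter of \<open>b\<close> and \<rho>' none of
      \<open>a\<close>, so filtering by the shuffle acts on each half as filtering by its own
      word.\<close>
    have restr_app: "restr (\<rho> @ \<rho>') u = abs_subst (preim \<rho> a @ preim \<rho>' b, u)"
      if "u \<in> shuffles a b" "set a \<subseteq> set \<rho>" "set b \<subseteq> set \<rho>'" for u a b
    proof -
      have "set u = set a \<union> set b"
        using that(1) by (rule set_shuffles)
      then have "preim \<rho> u = preim \<rho> a" "preim \<rho>' u = preim \<rho>' b"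
        using that q(3) unfolding preim_def by (auto intro!: filter_cong)
      then show ?thesis
        by (simp add: restr_def preim_def)
    qed
    have mul_restr: "dwha_mul (restr \<rho> a) (restr \<rho>' b) =
        shuffle_sum (\<lambda>u. frag_of (restr (\<rho> @ \<rho>') u)) a b"
      if "set a \<subseteq> set \<rho>" "set b \<subseteq> set \<rho>'" for a b
    proof -
      have "dwha_mul (restr \<rho> a) (restr \<rho>' b) =
          shuffle_sum (\<lambda>u. frag_of (abs_subst (preim \<rho> a @ preim \<rho>' b, u))) a b"
        unfolding restr_def using that q(3) by (intro dwha_mul_shuffle_sum) (auto simp: set_preim)
      also have "\<dots> = shuffle_sum (\<lambda>u. frag_of (restr (\<rho> @ \<rho>') u)) a b"
        by (rule shuffle_sum_cong) (simp add: restr_app that)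
      finally show ?thesis .
    qed
    \<comment> \<open>A letter common to both parts must come twice from \<sigma> or twice from
      \<sigma>', so goodness depends only on the two given cuts and not on the shuffles.\<close>
    have "shuffle_sum (\<lambda>u. shuffle_sum (?G (\<rho> @ \<rho>') u) a2 b2) a1 b1 =
        shuffle_sum (\<lambda>u. shuffle_sum (\<lambda>v. if set a1 \<inter> set a2 = {} \<and> set b1 \<inter> set b2 = {} then
          frag_of (restr (\<rho> @ \<rho>') u, restr (\<rho> @ \<rho>') v) else 0) a2 b2) a1 b1"
    proof (intro shuffle_sum_cong if_cong refl)
      fix u v assume "u \<in> shuffles a1 b1" "v \<in> shuffles a2 b2"
      then have "set u = set a1 \<union> set b1" "set v = set a2 \<union> set b2"
        by (simp_all add: set_shuffles)
      then show "set u \<inter> set v = {} \<longleftrightarrow> set a1 \<inter> set a2 = {} \<and> set b1 \<inter> set b2 = {}"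
        using sub q(3) by auto
    qed
    also have "\<dots> = mul2 dWHA (?G \<rho> a1 a2) (?G \<rho>' b1 b2)"
    proof (cases "set a1 \<inter> set a2 = {} \<and> set b1 \<inter> set b2 = {}")
      case True
      then show ?thesis
        by (simp add: mul_restr sub additive_shuffle_sum[OF additive_tens(1)])
          (simp add: additive_shuffle_sum[OF additive_tens(2)])
    next
      case False
      have "shuffle_sum (\<lambda>_. 0) a b = (0 :: subst \<times> subst \<Rightarrow>\<^sub>0 int)" for a b :: "nat list"
        by (simp add: shuffle_sum_def)
      with False show ?thesis
        by auto
    qed
    finally show "shuffle_sum (\<lambda>u. shuffle_sum (?G (\<rho> @ \<rho>') u) a2 b2) a1 b1 =
        mul2 dWHA (?G \<rho> a1 a2) (?G \<rho>' b1 b2)" .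
  qed
  also have "\<dots> = mul2 dWHA (dwha_comul p) (dwha_comul q)"
    by (simp add: p q dwha_comul_cut_sum additive_cut_sum[OF additive_mul2(1)])
      (simp add: additive_cut_sum[OF additive_mul2(2)])
  finally show ?thesis .
qed

text \<open>Every term has the same upper word, a concatenation of words with disjoint
  supports.\<close>

lemma dwha_mul_keys:
  assumes "r \<in> Poly_Mapping.keys (dwha_mul p q)"
  shows "dwha_deg r = dwha_deg p + dwha_deg q"
proof -
  obtain \<rho> \<sigma> where p: "p = abs_subst (\<rho>, \<sigma>)" "set \<rho> = set \<sigma>"
    using subst_cases[of "{}" p] by auto
  obtain \<rho>' \<sigma>' where q: "q = abs_subst (\<rho>', \<sigma>')" "set \<rho>' = set \<sigma>'" "set \<rho> \<inter> set \<rho>' = {}"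
    using subst_cases[of "set \<rho>" q] by (metis List.finite_set inf_commute)
  have keys: "Poly_Mapping.keys (\<Sum>\<gamma>\<leftarrow>xs. frag_of (h \<gamma>)) \<subseteq> h ` set xs" for h :: "nat list \<Rightarrow> subst" and xs
  proof (induction xs)
    case (Cons x xs)
    then show ?case
      using keys_add[of "frag_of (h x)" "\<Sum>\<gamma>\<leftarrow>xs. frag_of (h \<gamma>)"] by auto
  qed simp
  from assms obtain \<gamma> where "\<gamma> \<in> shuffles \<sigma> \<sigma>'" "r = abs_subst (\<rho> @ \<rho>', \<gamma>)"
    using keys[of "\<lambda>\<gamma>. abs_subst (\<rho> @ \<rho>', \<gamma>)" "shuffle \<sigma> \<sigma>'"]
    unfolding p(1) q(1) dwha_mul_abs[OF p(2) q(2,3)] set_shuffle by blast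
  moreover from this(1) have "set (\<rho> @ \<rho>') = set \<gamma>"
    using p q set_shuffles by fastforce
  ultimately have "dwha_deg r = card (set (\<rho> @ \<rho>'))"
    using dwha_deg_abs by blast
  then show ?thesis
    using p q by (simp add: dwha_deg_abs card_Un_disjoint)
qed

text \<open>Goodness of the cut is what makes the numbers of distinct letters add up.\<close>

lemma dwha_comul_keys:
  assumes "(r, s) \<in> Poly_Mapping.keys (dwha_comul p)"
  shows "dwha_deg r + dwha_deg s = dwha_deg p"
proof -
  obtain \<rho> \<sigma> where p: "p = abs_subst (\<rho>, \<sigma>)" "set \<rho> = set \<sigma>"
    using subst_cases[of "{}" p] by auto
  from assms obtain u v where uv: "(u, v) \<in> good_cuts \<sigma>" "r = restr \<rho> u" "s = restr \<rho> v"
    using keys_sum[of "\<lambda>(u, v). frag_of (restr \<rho> u, restr \<rho> v)" "good_cuts \<sigma>"]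
    unfolding p(1) dwha_comul_abs[OF p(2)] by (fastforce simp: restr_def)
  then have *: "\<sigma> = u @ v" "set u \<inter> set v = {}"
    by (auto simp: good_cuts_def cuts_def)
  then show ?thesis
    using p by (simp add: uv dwha_deg_restr dwha_deg_abs card_Un_disjoint)
qed

lemma dwha_deg_eq_0_iff: "dwha_deg p = 0 \<longleftrightarrow> p = abs_subst ([], [])"
proof -
  obtain \<rho> \<sigma> where p: "p = abs_subst (\<rho>, \<sigma>)" "set \<rho> = set \<sigma>"
    using subst_cases[of "{}" p] by auto
  then show ?thesis
    using restr_eq_empty_iff[of \<sigma> \<rho>] by (simp add: dwha_deg_abs restr_self)
qed

lemma dWHA_bialgebra: "is_bialgebra dWHA"
  unfolding is_bialgebra_def
proof (intro conjI allI dWHA_algebra dWHA_coalgebra)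
  show "comul dWHA (mul dWHA (tens x y)) = mul2 dWHA (comul dWHA x) (comul dWHA y)" for x y
  proof (induction x rule: frag_induct)
    case (of p)
    show ?case
      by (induction y rule: frag_induct) (simp_all add: dwha_comul_mul)
  qed simp_all
  show "comul dWHA (unit dWHA) = tens (unit dWHA) (unit dWHA)"
    by (simp add: dwha_comul_cut_sum restr_self)
  \<comment> \<open>Degrees add and only the empty substitution has degree 0, so it occurs in a
    product only if both factors are empty.\<close>
  have lookup_mul: "Poly_Mapping.lookup (dwha_mul p q) (abs_subst ([], [])) =
      (1 when p = abs_subst ([], [])) * (1 when q = abs_subst ([], []))" for p q
  proof (cases "p = abs_subst ([], []) \<and> q = abs_subst ([], [])")
    case True
    then show ?thesis
      by (simp add: dwha_mul_shuffle_sum)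
  next
    case False
    then have "dwha_deg p + dwha_deg q \<noteq> 0"
      by (simp add: dwha_deg_eq_0_iff)
    then have "abs_subst ([], []) \<notin> Poly_Mapping.keys (dwha_mul p q)"
      using dwha_mul_keys by (metis dwha_deg_eq_0_iff)
    then show ?thesis
      using False by (auto simp: in_keys_iff)
  qed
  show "counit dWHA (mul dWHA (tens x y)) = counit dWHA x * counit dWHA y" for x y
  proof (induction x rule: frag_induct)
    case (of p)
    show ?case
      by (induction y rule: frag_induct)
        (auto simp: lookup_mul lookup_minus when_def algebra_simps)
  qed (simp_all add: lookup_minus algebra_simps)
  show "counit dWHA (unit dWHA) = 1"
    by simp
qed

lemma dWHA_connected_graded_bialgebra: "connected_graded_bialgebra dWHA"
proof
  show "is_bialgebra dWHA"
    by (rule dWHA_bialgebra)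
  show "mul dWHA u \<in> hcomp dWHA n" if "u \<in> hcomp2 dWHA n" for u n
    using that keys_frag_extend[of "\<lambda>(p, q). dwha_mul p q" u]
    by (fastforce simp: hcomp_def hcomp2_def dWHA_def dest: dwha_mul_keys)
  show "unit dWHA \<in> hcomp dWHA 0"
    by (simp add: hcomp_def dwha_deg_eq_0_iff)
  show "comul dWHA x \<in> hcomp2 dWHA n" if "x \<in> hcomp dWHA n" for x n
    using that keys_frag_extend[of dwha_comul x]
    by (fastforce simp: hcomp_def hcomp2_def dWHA_def dest: dwha_comul_keys)
  show "counit dWHA x = 0" if "x \<in> hcomp dWHA n" "n > 0" for x n
  proof -
    have "abs_subst ([], []) \<notin> Poly_Mapping.keys x"
      using that by (auto simp: hcomp_def dwha_deg_eq_0_iff[THEN iffD2])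
    then show ?thesis
      by (simp add: in_keys_iff)
  qed
  have "x \<in> range (\<lambda>k. frag_cmul k (unit dWHA))" if "x \<in> hcomp dWHA 0" for x
  proof -
    let ?e = "abs_subst ([], [])"
    have "Poly_Mapping.lookup x p = 0" if "p \<noteq> ?e" for p
      using that \<open>x \<in> hcomp dWHA 0\<close> by (auto simp: hcomp_def dwha_deg_eq_0_iff in_keys_iff)
    then have "x = frag_cmul (Poly_Mapping.lookup x ?e) (frag_of ?e)"
      by (intro poly_mapping_eqI) (auto simp: lookup_single when_def)
    then show ?thesis
      by auto
  qed
  moreover have "frag_cmul k (unit dWHA) \<in> hcomp dWHA 0" for k
    by (auto simp: hcomp_def dwha_deg_eq_0_iff)
  moreover have "inj (\<lambda>k. frag_cmul k (unit dWHA))"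
    by (rule injI) (metis dWHA_simps(4) lookup_frag_cmul lookup_single_eq mult.right_neutral)
  ultimately show "bij_betw (\<lambda>k. frag_cmul k (unit dWHA)) UNIV (hcomp dWHA 0)"
    by (auto simp: bij_betw_def)
qed


section \<open>Permutations as substitutions\<close>

definition perm_subst :: "perm_word \<Rightarrow> subst" where
  "perm_subst p = abs_subst ([1..<length (Rep_perm_word p) + 1], Rep_perm_word p)"

lemma phi_eq_frag_map: "phi = frag_map perm_subst"
  by (simp add: phi_def frag_map_def perm_subst_def Let_def comp_def)

lemma set_Rep_perm_word: "set (Rep_perm_word p) = {1..length (Rep_perm_word p)}"
  and distinct_Rep_perm_word: "distinct (Rep_perm_word p)"
  using Rep_perm_word[of p] by auto

lemma set_upt_perm_word: "set [1..<length (Rep_perm_word p) + 1] = set (Rep_perm_word p)"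
  unfolding set_Rep_perm_word by auto

lemma perm_subst_Abs:
  assumes "w \<in> {w. distinct w \<and> set w = {1..length w}}"
  shows "perm_subst (Abs_perm_word w) = abs_subst ([1..<length w + 1], w)"
  using Abs_perm_word_inverse[OF assms] by (simp add: perm_subst_def)

text \<open>A renaming between two such substitutions maps the word 1, ..., n to itself, so it fixes
  every letter and the lower words coincide.\<close>

lemma inj_perm_subst: "inj perm_subst"
proof (rule injI)
  fix p q assume eq: "perm_subst p = perm_subst q"
  let ?p = "Rep_perm_word p" and ?q = "Rep_perm_word q"
  have self: "renaming ([1..<length (Rep_perm_word r) + 1], Rep_perm_word r)
      ([1..<length (Rep_perm_word r) + 1], Rep_perm_word r)" for r
    using renaming_map[OF set_upt_perm_word, of id r] by simp
  have "renaming ([1..<length ?p + 1], ?p) ([1..<length ?q + 1], ?q)"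
    using eq self[of p] self[of q] Quotient3_rel[OF Quotient3_subst] unfolding perm_subst_def by blast
  then obtain f where f: "map f [1..<length ?p + 1] = [1..<length ?q + 1]" "map f ?p = ?q"
    by (auto simp: renaming_def)
  have len: "length ?p = length ?q"
    using map_eq_imp_length_eq[of f ?p id ?q] f(2) by simp
  have "map f [1..<length ?p + 1] = map id [1..<length ?p + 1]"
    using f(1) len by (simp del: upt_Suc)
  then have "map f ?p = ?p"
    unfolding map_eq_conv set_upt_perm_word by (simp add: map_idI)
  with f(2) show "p = q"
    by (simp add: Rep_perm_word_inject)
qed

text \<open>With \<open>k\<close> the length of another permutation, this representative is disjoint
  from that one's, and the upper words join to one increasing interval. The shift is the one in the
  product of permutations.\<close>

lemma perm_subst_shift:
  "perm_subst q = abs_subst ([k + 1..<k + length (Rep_perm_word q) + 1], map ((+) k) (Rep_perm_word q))"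
proof -
  have "map ((+) k) [1..<length (Rep_perm_word q) + 1] = [k + 1..<k + length (Rep_perm_word q) + 1]"
    by (rule nth_equalityI) (auto simp del: upt_Suc)
  then show ?thesis
    using abs_subst_map[OF set_upt_perm_word, of "(+) k" q] by (simp add: perm_subst_def)
qed

lemma perm_subst_mul: "frag_map perm_subst (mpr_mul p q) = dwha_mul (perm_subst p) (perm_subst q)"
proof -
  let ?a = "Rep_perm_word p" and ?b = "Rep_perm_word q"
  let ?m = "length ?a" and ?n = "length ?b"
  let ?b' = "map ((+) ?m) ?b"
  have set_b': "set [?m + 1..<?m + ?n + 1] = set ?b'"
    using set_Rep_perm_word[of q] by (auto simp: image_iff)
  have disj: "set [1..<?m + 1] \<inter> set [?m + 1..<?m + ?n + 1] = {}"
    by auto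
  have upt: "[1..<?m + 1] @ [?m + 1..<?m + ?n + 1] = [1..<?m + ?n + 1]"
    using upt_add_eq_append[of 1 "?m + 1" ?n] by simp
  have "frag_map perm_subst (mpr_mul p q) =
      (\<Sum>\<gamma>\<leftarrow>shuffle ?a ?b'. frag_of (perm_subst (Abs_perm_word \<gamma>)))"
    by (simp add: mpr_mul_def Let_def additive_simps(5)[OF additive_frag_map] comp_def)
  also have "\<dots> = (\<Sum>\<gamma>\<leftarrow>shuffle ?a ?b'. frag_of (abs_subst ([1..<?m + ?n + 1], \<gamma>)))"
  proof (intro arg_cong[where f = sum_list] map_cong refl)
    fix \<gamma> assume \<gamma>: "\<gamma> \<in> set (shuffle ?a ?b')"
    then have "length \<gamma> = ?m + ?n"
      using length_shuffles[of \<gamma> ?a ?b'] by (simp add: set_shuffle)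
    then show "frag_of (perm_subst (Abs_perm_word \<gamma>)) = frag_of (abs_subst ([1..<?m + ?n + 1], \<gamma>))"
      using perm_subst_Abs[OF mpr_mul_in_perm_word[OF \<gamma>]] by simp
  qed
  also have "\<dots> = dwha_mul (perm_subst p) (perm_subst q)"
    unfolding perm_subst_shift[of q ?m] perm_subst_def[of p]
      dwha_mul_abs[OF set_upt_perm_word set_b' disj] upt ..
  finally show ?thesis .
qed

text \<open>Standardization is a renaming: \<open>preim\<close> lists the letters of
  \<open>u\<close> in increasing order, so the increasing map \<open>st_map u\<close> sends this
  list to 1, ..., |u| and \<open>u\<close> to \<open>st u\<close>.\<close>

lemma perm_subst_standardize:
  assumes "distinct u" "set u \<subseteq> {1..n}"
  shows "perm_subst (Abs_perm_word (st u)) = abs_subst (preim [1..<n + 1] u, u)"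
proof -
  let ?r = "preim [1..<n + 1] u"
  have set_r: "set ?r = set u"
    using assms(2) by (auto simp: preim_def)
  have "map (st_map u) ?r = [1..<length u + 1]"
  proof (rule sorted_distinct_set_unique)
    have sorted: "sorted ?r"
      by (simp add: preim_def sorted_wrt_filter del: upt_Suc)
    have mono: "mono_on (set u) (st_map u)"
      by (rule strict_mono_on_imp_mono_on[OF st_map_strict_mono])
    show "sorted (map (st_map u) ?r)"
      unfolding sorted_map
      by (rule sorted_wrt_mono_rel[OF _ sorted]) (auto simp only: set_r intro: mono_onD[OF mono])
    show "distinct (map (st_map u) ?r)"
      using st_map_bij[OF assms(1)] set_r by (simp add: distinct_map bij_betw_def preim_def)
    show "set (map (st_map u) ?r) = set [1..<length u + 1]"
      using st_map_bij[OF assms(1)] set_r by (auto simp: bij_betw_def)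
  qed (simp_all del: upt_Suc)
  moreover have "abs_subst (map (st_map u) ?r, map (st_map u) u) = abs_subst (?r, u)"
    using st_map_bij[OF assms(1)] by (intro abs_subst_map) (simp_all only: set_r bij_betw_def)
  ultimately show ?thesis
    using perm_subst_Abs[OF st_in_perm_word[OF assms(1)]] by (simp add: st_def)
qed

text \<open>In a word without repeated letters every cut is good, and each piece is handled by
  standardization.\<close>

lemma perm_subst_comul:
  "dwha_comul (perm_subst p) =
   tens_map (frag_map perm_subst) (frag_map perm_subst) (mpr_comul p)"
proof -
  let ?w = "Rep_perm_word p"
  let ?r = "[1..<length ?w + 1]"
  have "good_cuts ?w = cuts ?w"
    using distinct_Rep_perm_word[of p] by (auto simp: good_cuts_def cuts_def dest!: sym[of _ ?w])
  then have "dwha_comul (perm_subst p) =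
      (\<Sum>(u, v)\<in>cuts ?w. frag_of (abs_subst (preim ?r u, u), abs_subst (preim ?r v, v)))"
    unfolding perm_subst_def dwha_comul_abs[OF set_upt_perm_word] by simp
  also have "\<dots> = (\<Sum>(u, v)\<in>cuts ?w.
      frag_of (perm_subst (Abs_perm_word (st u)), perm_subst (Abs_perm_word (st v))))"
  proof (intro sum.cong refl, clarify)
    fix u v assume "(u, v) \<in> cuts ?w"
    then have w: "?w = u @ v"
      by (simp add: cuts_def)
    then have "distinct u" "distinct v" "set u \<subseteq> {1..length ?w}" "set v \<subseteq> {1..length ?w}"
      using distinct_Rep_perm_word[of p] set_Rep_perm_word[of p] by auto
    then show "frag_of (abs_subst (preim ?r u, u), abs_subst (preim ?r v, v)) =
        frag_of (perm_subst (Abs_perm_word (st u)), perm_subst (Abs_perm_word (st v)))"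
      using perm_subst_standardize by metis
  qed
  also have "\<dots> = tens_map (frag_map perm_subst) (frag_map perm_subst) (mpr_comul p)"
    by (simp add: mpr_comul_def additive_simps(4)[OF additive_tens_map] case_prod_unfold)
  finally show ?thesis .
qed

lemma perm_subst_Nil: "perm_subst (Abs_perm_word []) = abs_subst ([], [])"
  by (simp add: perm_subst_Abs)

section \<open>Compatibility of \<open>phi\<close> with the structure maps\<close>

lemma MPR_simps [simp]:
  "mul MPR 0 = 0" "mul MPR (u - v) = mul MPR u - mul MPR v"
  "mul MPR (frag_of (p, q)) = mpr_mul p q"
  "unit MPR = frag_of (Abs_perm_word [])"
  "comul MPR 0 = 0" "comul MPR (x - y) = comul MPR x - comul MPR y"
  "comul MPR (frag_of p) = mpr_comul p"
  "counit MPR x = Poly_Mapping.lookup x (Abs_perm_word [])"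
  "deg MPR p = length (Rep_perm_word p)"
  by (simp_all add: MPR_def frag_extend_diff)

lemma additive_MPR: "additive (mul MPR)" "additive (comul MPR)" "additive (counit MPR)"
  by (simp_all add: additive_diffI lookup_minus)

lemma phi_mul: "phi (mul MPR (tens x y)) = mul dWHA (tens (phi x) (phi y))"
  unfolding phi_eq_frag_map
proof (induction x rule: frag_induct)
  case (of p)
  show ?case
    by (induction y rule: frag_induct) (simp_all add: perm_subst_mul)
qed simp_all

lemma phi_unit: "phi (unit MPR) = unit dWHA"
  by (simp add: phi_eq_frag_map perm_subst_Nil)

lemma phi_comul: "comul dWHA (phi x) = tens_map phi phi (comul MPR x)"
  unfolding phi_eq_frag_map by (induction x rule: frag_induct) (simp_all add: perm_subst_comul)

text \<open>By injectivity on bases only the empty permutation reaches the empty substitution, so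
  the coefficient is unchanged.\<close>

lemma phi_counit: "counit dWHA (phi x) = counit MPR x"
  unfolding phi_eq_frag_map
  by (induction x rule: frag_induct)
    (auto simp: lookup_minus lookup_single when_def perm_subst_Nil[symmetric] inj_eq[OF inj_perm_subst])

lemma deg_perm_subst: "deg dWHA (perm_subst p) = deg MPR p"
  unfolding dWHA_simps MPR_simps perm_subst_def dwha_deg_abs[OF set_upt_perm_word]
  by (simp del: upt_Suc)

lemma MPR_connected_graded_bialgebra: "connected_graded_bialgebra MPR"
  using dWHA_connected_graded_bialgebra inj_perm_subst additive_MPR phi_mul phi_unit phi_comul
    phi_counit deg_perm_subst
  unfolding phi_eq_frag_map by (rule connected_graded_bialgebra_pullback)

theorem theorem7p2:
  shows "connected_graded_hopf_mono MPR dWHA phi"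
proof -
  have hopf: "is_connected_graded_hopf_algebra MPR" "is_connected_graded_hopf_algebra dWHA"
    using MPR_connected_graded_bialgebra dWHA_connected_graded_bialgebra
    by (simp_all add: connected_graded_bialgebra.connected_graded_hopf_algebra)
  have additive: "additive phi"
    by (simp add: phi_eq_frag_map additive_frag_map)
  have "phi (antipode MPR x) = antipode dWHA (phi x)" for x
    using hopf by (intro bialgebra_hom_antipode additive phi_mul phi_unit phi_comul phi_counit)
      (simp_all add: is_connected_graded_hopf_algebra_def is_graded_hopf_algebra_def)
  moreover have "phi ` hcomp MPR n \<subseteq> hcomp dWHA n" for n
    using deg_perm_subst by (auto simp: hcomp_def phi_eq_frag_map keys_frag_map inj_perm_subst
      simp del: dWHA_simps MPR_simps)
  ultimately have "is_graded_hopf_hom MPR dWHA phi"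
    unfolding is_graded_hopf_hom_def
    using additive phi_mul phi_unit phi_comul phi_counit by blast
  moreover have "inj phi"
    by (simp add: phi_eq_frag_map inj_frag_map inj_perm_subst)
  ultimately show ?thesis
    using hopf by (simp add: connected_graded_hopf_mono_def)
qed

end
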